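(* For any two finite groups $G$ and $H$, each of the following limits exists in $\mathbb{Q} \cup \{\infty\}$: \[ \lim_{n\to\infty} \frac{| \{\mathcal{M} \in \mathbf{S}_n : H \leq \mathrm{Aut}(\mathcal{M})\} |}{| \{\mathcal{M} \in \mathbf{S}_n : G \leq \mathrm{Aut}(\mathcal{M})\} |}, \quad \lim_{n\to\infty} \frac{| \{\mathcal{M} \in \mathbf{S}_n : H \cong \mathrm{Aut}(\mathcal{M})\} |}{| \{\mathcal{M} \in \mathbf{S}_n : G \cong \mathrm{Aut}(\mathcal{M})\} |}, \] \[ \lim_{n\to\infty} \frac{| \{\mathcal{M} \in \mathbf{S}_n : G \cong \mathrm{Aut}(\mathcal{M})\} |}{| \{\mathcal{M} \in \mathbf{S}_n : G \leq \mathrm{Aut}(\mathcal{M})\} |}. \]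
   Context: Fix a finite relational vocabulary $\{R_1,\dots,R_\rho\}$ (no function or constant symbols), where $R_i$ has arity $r_i$, and let $r=\max\{r_1,\dots,r_\rho\}$; it is assumed that $r \geq 2$. A structure is $\mathcal{M}=(M,R_1^{\mathcal{M}},\dots,R_\rho^{\mathcal{M}})$ with $R_i^{\mathcal{M}} \subseteq M^{r_i}$. For $n \geq 1$, $[n]=\{1,\dots,n\}$ and $\mathbf{S}_n$ is the (finite) set of all structures with universe $[n]$ (so structures are labelled). $\mathrm{Aut}(\mathcal{M})$ is the automorphism group of $\mathcal{M}$. For groups, $G \cong H$ means isomorphic as abstract groups and $G \leq H$ means $G$ is isomorphic to a subgroup of $H$. *)

theory Defs
  imports Complex_Main "HOL-Library.Extended_Real" "HOL-Algebra.Bij"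
begin

text \<open>
  A vocabulary consists of relation symbols \<open>1, \<dots>, \<rho>\<close>, the \<open>i\<close>-th one having arity \<open>ar i\<close>;
  the values of \<open>ar\<close> outside \<open>{1..\<rho>}\<close> are irrelevant.
\<close>

record 'a rel_structure =
  universe :: "'a set"
  rel :: "nat \<Rightarrow> 'a list set"

definition tuples :: "nat \<Rightarrow> 'a set \<Rightarrow> 'a list set"
  where "tuples k M = {xs. length xs = k \<and> set xs \<subseteq> M}"

text \<open>
  The second conjunct fixes the junk value of \<^const>\<open>rel\<close> at indices that are not relation symbols,
  so that a structure is determined by its universe and its \<open>\<rho>\<close> relations, as needed for counting.
\<close>
definition is_structure :: "nat \<Rightarrow> (nat \<Rightarrow> nat) \<Rightarrow> 'a rel_structure \<Rightarrow> bool"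
  where "is_structure \<rho> ar \<M> \<longleftrightarrow>
    (\<forall>i\<in>{1..\<rho>}. rel \<M> i \<subseteq> tuples (ar i) (universe \<M>)) \<and>
    (\<forall>i. i \<notin> {1..\<rho>} \<longrightarrow> rel \<M> i = {})"

definition structures_on :: "nat \<Rightarrow> (nat \<Rightarrow> nat) \<Rightarrow> nat \<Rightarrow> nat rel_structure set"
  where "structures_on \<rho> ar n = {\<M>. is_structure \<rho> ar \<M> \<and> universe \<M> = {1..n}}"

definition automorphisms :: "nat \<Rightarrow> (nat \<Rightarrow> nat) \<Rightarrow> 'a rel_structure \<Rightarrow> ('a \<Rightarrow> 'a) set"
  where "automorphisms \<rho> ar \<M> =
    {f \<in> Bij (universe \<M>).
      \<forall>i\<in>{1..\<rho>}. \<forall>xs\<in>tuples (ar i) (universe \<M>). map f xs \<in> rel \<M> i \<longleftrightarrow> xs \<in> rel \<M> i}"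

definition Aut :: "nat \<Rightarrow> (nat \<Rightarrow> nat) \<Rightarrow> 'a rel_structure \<Rightarrow> ('a \<Rightarrow> 'a) monoid"
  where "Aut \<rho> ar \<M> = BijGroup (universe \<M>) \<lparr>carrier := automorphisms \<rho> ar \<M>\<rparr>"

definition iso_to_subgroup :: "('a, 'c) monoid_scheme \<Rightarrow> ('b, 'd) monoid_scheme \<Rightarrow> bool"
  (infix \<open>\<lesssim>\<^sub>g\<close> 60)
  where "G \<lesssim>\<^sub>g H \<longleftrightarrow> (\<exists>K. subgroup K H \<and> G \<cong> H\<lparr>carrier := K\<rparr>)"

text \<open>
  Since division by zero is total in HOL, the quotients being defined for all sufficiently large
  \<open>n\<close>, which is part of the existence of the limit, has to be stated explicitly.
\<close>
definition quotient_limit_exists :: "(nat \<Rightarrow> nat) \<Rightarrow> (nat \<Rightarrow> nat) \<Rightarrow> bool"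
  where "quotient_limit_exists a b \<longleftrightarrow>
    (\<forall>\<^sub>F n in sequentially. b n \<noteq> 0) \<and>
    (\<exists>L \<in> ereal ` \<rat> \<union> {\<infinity>}. (\<lambda>n. ereal (real (a n) / real (b n))) \<longlonglongrightarrow> L)"

lemma finite_tuples: "finite M \<Longrightarrow> finite (tuples k M)"
  unfolding tuples_def by (rule finite_subset[OF _ finite_lists_length_eq[of M k]]) auto

lemma finite_structures_on: "finite (structures_on \<rho> ar n)"
proof -
  let ?P = "PiE {1..\<rho>} (\<lambda>i. Pow (tuples (ar i) {1..n}))"
  let ?f = "\<lambda>R. \<lparr>universe = {1..n}, rel = (\<lambda>i. if i \<in> {1..\<rho>} then R i else {})\<rparr>"
  have "\<M> \<in> ?f ` ?P" if M: "\<M> \<in> structures_on \<rho> ar n" for \<M>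
  proof (rule image_eqI)
    show "\<M> = ?f (restrict (rel \<M>) {1..\<rho>})"
      using M by (cases \<M>) (auto simp: structures_on_def is_structure_def fun_eq_iff)
    show "restrict (rel \<M>) {1..\<rho>} \<in> ?P"
      unfolding restrict_PiE_iff
    proof
      fix i assume "i \<in> {1..\<rho>}"
      moreover have "universe \<M> = {1..n}" "is_structure \<rho> ar \<M>"
        using M by (simp_all add: structures_on_def)
      ultimately show "rel \<M> i \<in> Pow (tuples (ar i) {1..n})"
        unfolding is_structure_def by (metis PowI)
    qed
  qed
  then have "structures_on \<rho> ar n \<subseteq> ?f ` ?P" by blast
  moreover have "finite ?P" by (intro finite_PiE) (auto simp: finite_tuples)
  ultimately show ?thesis by (meson finite_imageI finite_subset)
qed

lemma subgroup_automorphisms: "subgroup (automorphisms \<rho> ar \<M>) (BijGroup (universe \<M>))"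
proof -
  let ?U = "universe \<M>"
  have tup: "map f xs \<in> tuples k ?U" if "f \<in> Bij ?U" "xs \<in> tuples k ?U" for f xs k
    using that Bij_imp_funcset[of f ?U] by (auto simp: tuples_def)
  have comp: "map (compose ?U f g) xs = map f (map g xs)" if "xs \<in> tuples k ?U" for f g xs k
    using that by (auto simp: tuples_def compose_def)
  have ident: "map (\<lambda>x\<in>?U. x) xs = xs" if "xs \<in> tuples k ?U" for xs k
    using that unfolding tuples_def by (intro map_idI) auto
  interpret group "BijGroup ?U" by (rule group_BijGroup)
  show ?thesis
  proof (rule subgroupI)
    show "automorphisms \<rho> ar \<M> \<subseteq> carrier (BijGroup ?U)"
      by (auto simp: automorphisms_def BijGroup_def)
    have "(\<lambda>x\<in>?U. x) \<in> automorphisms \<rho> ar \<M>"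
      using ident by (auto simp: automorphisms_def id_Bij)
    then show "automorphisms \<rho> ar \<M> \<noteq> {}" by blast
  next
    fix f assume f: "f \<in> automorphisms \<rho> ar \<M>"
    then have fB: "f \<in> Bij ?U" by (simp add: automorphisms_def)
    let ?g = "restrict (inv_into ?U f) ?U"
    have inv: "inv\<^bsub>BijGroup ?U\<^esub> f = ?g" using fB by (rule inv_BijGroup)
    have gB: "?g \<in> Bij ?U" using fB by (rule restrict_inv_into_Bij)
    have "map f (map ?g xs) = xs" if "xs \<in> tuples k ?U" for xs k
      using that fB by (auto simp: tuples_def Bij_def bij_betw_def subset_iff f_inv_into_f intro!: map_idI)
    then have "map ?g xs \<in> rel \<M> i \<longleftrightarrow> xs \<in> rel \<M> i"
      if "i \<in> {1..\<rho>}" "xs \<in> tuples (ar i) ?U" for i xs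
      using f that tup[OF gB that(2)] by (fastforce simp: automorphisms_def simp del: map_map)
    then show "inv\<^bsub>BijGroup ?U\<^esub> f \<in> automorphisms \<rho> ar \<M>"
      using gB inv by (simp add: automorphisms_def)
  next
    fix f g assume "f \<in> automorphisms \<rho> ar \<M>" "g \<in> automorphisms \<rho> ar \<M>"
    then show "f \<otimes>\<^bsub>BijGroup ?U\<^esub> g \<in> automorphisms \<rho> ar \<M>"
      using tup by (auto simp: automorphisms_def BijGroup_def compose_Bij comp simp del: map_map)
  qed
qed

lemma group_Aut: "group (Aut \<rho> ar \<M>)"
  unfolding Aut_def by (rule subgroup.subgroup_is_group[OF subgroup_automorphisms group_BijGroup])

end

theory Submission
  imports Defs "HOL-Algebra.Group_Action" "HOL-Combinatorics.Permutations"
    "HOL-Computational_Algebra.Polynomial" "HOL-Real_Asymp.Real_Asymp"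
begin

text \<open>
  By Burnside's lemma, the number of structures on \<open>{1..n}\<close> invariant under a fixed permutation
  group \<open>K\<close> is \<open>2 ^ e n\<close>, where \<open>card K * e n\<close> is an integer polynomial in \<open>n\<close>. Descending
  induction on \<open>K\<close> shows that the proportion of those for which \<open>K\<close> is the whole group of
  automorphisms moving only points of the support of \<open>K\<close> has a rational limit, positive
  as soon as one such structure exists. For a property of groups, let \<open>D\<close> be
  the least defect (number of points minus number of orbits) of such a realized \<open>K\<close> with the
  property. Structures whose automorphism group has defect greater than \<open>D\<close> are negligible: either
  some automorphism moves many points, or already the automorphisms supported on a bounded set have
  defect greater than \<open>D\<close>, and both cost an exponential factor. As a group of defect \<open>D\<close> moves at
  most \<open>2 * D\<close> points, only finitely many groups up to conjugation remain; each of them with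
  \<open>s\<close> points in its support contributes asymptotically a rational multiple of
  \<open>n ^ s * 2 ^ e n\<close>, and quotients of such functions always have a limit in \<open>\<rat> \<union> {\<infinity>}\<close>.
\<close>

section \<open>Permutation groups and their orbits\<close>

text \<open>The obstacle is that automorphism groups live on all of \<open>{1..n}\<close>, so the
  range of possible groups grows with \<open>n\<close>. Stabilizers relative to a fixed set
  \<open>S\<close> avoid this: the subgroups of Sym(S) form a finite lattice independent of
  \<open>n\<close>, over which limits can be taken term by term. Automorphisms moving points outside
  \<open>S\<close> are dealt with last: they join orbits and so raise the defect.

  The minimum of the defect must run over groups that occur as stabilizers: an alternating group on
  many points has the same orbits on short tuples as the symmetric group and is never a stabilizer.

  The defect decides because, to first order, the exponent of \<open>K\<close> is
  \<open>card (cells n) - defect K * loss n\<close>, where \<open>loss n\<close> is the derivative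
  of the number of cells and at least \<open>2 * n\<close>, some arity being at least two. One more
  unit of defect thus costs an exponential factor, whereas supports of bounded size are polynomially
  many, and a permutation moving \<open>m\<close> points has at most \<open>n ^ (2 * m)\<close>
  choices against a gain of order \<open>m * n\<close> in the exponent. Groups of equal defect may
  still differ in lower-order terms of the exponent, which is why general polynomials have to be
  compared.\<close>

abbreviation perm_inv :: "('v \<Rightarrow> 'v) \<Rightarrow> 'v \<Rightarrow> 'v"
  where "perm_inv \<equiv> inv_into UNIV"

text \<open>Elements are total functions that are the identity outside \<open>S\<close>, so one and
  the same \<open>K\<close> is a group over every larger set; the extensional functions of
  \<open>BijGroup\<close> would change with the universe.\<close>

definition perm_group :: "'v set \<Rightarrow> ('v \<Rightarrow> 'v) set \<Rightarrow> bool"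
  where "perm_group S K \<longleftrightarrow> (\<forall>f\<in>K. f permutes S) \<and> id \<in> K \<and>
    (\<forall>f\<in>K. \<forall>g\<in>K. f \<circ> g \<in> K) \<and> (\<forall>f\<in>K. perm_inv f \<in> K)"

definition PermGroup :: "('v \<Rightarrow> 'v) set \<Rightarrow> ('v \<Rightarrow> 'v) monoid"
  where "PermGroup K = \<lparr>carrier = K, monoid.mult = (\<circ>), monoid.one = id\<rparr>"

lemma PermGroup_simps [simp]:
  "carrier (PermGroup K) = K" "f \<otimes>\<^bsub>PermGroup K\<^esub> g = f \<circ> g" "\<one>\<^bsub>PermGroup K\<^esub> = id"
  by (simp_all add: PermGroup_def)

lemma perm_groupD:
  assumes "perm_group S K"
  shows "f \<in> K \<Longrightarrow> f permutes S" "id \<in> K" "f \<in> K \<Longrightarrow> g \<in> K \<Longrightarrow> f \<circ> g \<in> K"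
    "f \<in> K \<Longrightarrow> perm_inv f \<in> K"
  using assms unfolding perm_group_def by auto

lemma group_PermGroup: "perm_group S K \<Longrightarrow> group (PermGroup K)"
proof (rule groupI)
  fix f assume "perm_group S K" "f \<in> carrier (PermGroup K)"
  then show "\<exists>g\<in>carrier (PermGroup K). g \<otimes>\<^bsub>PermGroup K\<^esub> f = \<one>\<^bsub>PermGroup K\<^esub>"
    using permutes_inv_o(2)[of f S] perm_groupD(1,4)[of S K f] by auto
qed (auto simp: perm_group_def o_assoc)

lemma perm_group_mono: "perm_group S K \<Longrightarrow> S \<subseteq> T \<Longrightarrow> perm_group T K"
  unfolding perm_group_def using permutes_subset by blast

lemma finite_perm_group: "perm_group S K \<Longrightarrow> finite S \<Longrightarrow> finite K"
  by (rule finite_subset[OF _ finite_permutations[of S]]) (auto simp: perm_group_def)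

lemma perm_group_card_pos: "perm_group S K \<Longrightarrow> finite S \<Longrightarrow> card K > 0"
  using finite_perm_group[of S K] perm_groupD(2)[of S K] by (auto simp: card_gt_0_iff)

text \<open>Saturating by \<open>r'\<close> maps the classes of \<open>r\<close> onto those of
  \<open>r'\<close>, and a pair in \<open>r'\<close> but not in \<open>r\<close> gives two classes
  with the same image.\<close>

lemma
  assumes r: "equiv A r" and r': "equiv A r'" and sub: "r \<subseteq> r'" and fin: "finite A"
  shows card_quotient_mono: "card (A // r') \<le> card (A // r)"
    and card_quotient_strict_mono: "r \<noteq> r' \<Longrightarrow> card (A // r') < card (A // r)"
proof -
  have fq: "finite (A // r)" using fin r by (intro finite_quotient) (auto simp: equiv_def)
  have im: "r' `` (r `` {x}) = r' `` {x}" if "x \<in> A" for x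
  proof
    show "r' `` (r `` {x}) \<subseteq> r' `` {x}"
      using r' sub unfolding equiv_def trans_def by blast
    show "r' `` {x} \<subseteq> r' `` (r `` {x})"
      using equiv_class_self[OF r that] by blast
  qed
  have eq: "A // r' = (\<lambda>C. r' `` C) ` (A // r)"
    using im by (auto simp: quotient_def image_iff)
  show "card (A // r') \<le> card (A // r)"
    unfolding eq using fq by (rule card_image_le)
  assume "r \<noteq> r'"
  then obtain x y where xy: "(x, y) \<in> r'" "(x, y) \<notin> r" using sub by auto
  have A: "x \<in> A" "y \<in> A" using xy r' by (auto simp: equiv_def refl_on_def)
  have "\<not> inj_on (\<lambda>C. r' `` C) (A // r)"
  proof
    assume "inj_on (\<lambda>C. r' `` C) (A // r)"
    moreover have "r' `` (r `` {x}) = r' `` (r `` {y})"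
      using im A xy(1) equiv_class_eq[OF r'] by auto
    ultimately have "r `` {x} = r `` {y}" using A by (auto simp: inj_on_def quotient_def)
    then show False using xy(2) eq_equiv_class[OF _ r A(2)] by auto
  qed
  then show "card (A // r') < card (A // r)"
    unfolding eq using fq card_image_le[OF fq, of "\<lambda>C. r' `` C"] eq_card_imp_inj_on[OF fq, of "\<lambda>C. r' `` C"]
    by (auto simp: le_less)
qed

definition orbit_rel :: "('v \<Rightarrow> 'v) set \<Rightarrow> (('v \<Rightarrow> 'v) \<Rightarrow> 'x \<Rightarrow> 'x) \<Rightarrow> 'x set \<Rightarrow> ('x \<times> 'x) set"
  where "orbit_rel K a X = {(x, y). x \<in> X \<and> (\<exists>f\<in>K. y = a f x)}"

definition num_orbits :: "('v \<Rightarrow> 'v) set \<Rightarrow> (('v \<Rightarrow> 'v) \<Rightarrow> 'x \<Rightarrow> 'x) \<Rightarrow> 'x set \<Rightarrow> nat"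
  where "num_orbits K a X = card (X // orbit_rel K a X)"

text \<open>Used with two actions of the same group: on points by application, which yields the
  defect, and on cells by \<open>act\<close>, which yields the exponent.\<close>

locale perm_action =
  fixes S :: "'v set" and K :: "('v \<Rightarrow> 'v) set" and a :: "('v \<Rightarrow> 'v) \<Rightarrow> 'x \<Rightarrow> 'x" and X :: "'x set"
  assumes pg: "perm_group S K" and finS: "finite S" and finX: "finite X"
    and closed: "f \<in> K \<Longrightarrow> x \<in> X \<Longrightarrow> a f x \<in> X"
    and a_id: "x \<in> X \<Longrightarrow> a id x = x"
    and a_comp: "f \<in> K \<Longrightarrow> g \<in> K \<Longrightarrow> x \<in> X \<Longrightarrow> a (f \<circ> g) x = a f (a g x)"
begin

lemma a_inv: "f \<in> K \<Longrightarrow> x \<in> X \<Longrightarrow> a (perm_inv f) (a f x) = x"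
  using a_comp[of "perm_inv f" f x] perm_groupD(1,4)[OF pg, of f] a_id permutes_inv_o(2)[of f S] by simp

lemma a_inv': "f \<in> K \<Longrightarrow> x \<in> X \<Longrightarrow> a f (a (perm_inv f) x) = x"
  using a_comp[of f "perm_inv f" x] perm_groupD(1,4)[OF pg, of f] a_id permutes_inv_o(1)[of f S] by simp

lemma equiv_orbit_rel: "equiv X (orbit_rel K a X)"
proof (rule equivI)
  show "orbit_rel K a X \<subseteq> X \<times> X" using closed by (auto simp: orbit_rel_def)
  show "refl_on X (orbit_rel K a X)"
    using perm_groupD(2)[OF pg] a_id by (force simp: orbit_rel_def refl_on_def)
  show "sym (orbit_rel K a X)"
    using closed a_inv perm_groupD(4)[OF pg] by (force simp: orbit_rel_def sym_def)
  show "trans (orbit_rel K a X)"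
    using a_comp perm_groupD(3)[OF pg] unfolding orbit_rel_def trans_def
    by (clarsimp) metis
qed

lemma bij_act: "f \<in> K \<Longrightarrow> bij_betw (a f) X X"
  by (rule bij_betwI[where g = "a (perm_inv f)"]) (auto simp: closed a_inv a_inv' perm_groupD[OF pg])

lemma group_action_restrict: "group_action (PermGroup K) X (\<lambda>f. restrict (a f) X)"
proof -
  have "(\<lambda>f. restrict (a f) X) \<in> hom (PermGroup K) (BijGroup X)"
  proof (rule homI)
    fix f assume "f \<in> carrier (PermGroup K)"
    then show "restrict (a f) X \<in> carrier (BijGroup X)"
      using bij_act by (simp add: BijGroup_def Bij_def)
  next
    fix f g assume "f \<in> carrier (PermGroup K)" "g \<in> carrier (PermGroup K)"
    then show "restrict (a (f \<otimes>\<^bsub>PermGroup K\<^esub> g)) X = restrict (a f) X \<otimes>\<^bsub>BijGroup X\<^esub> restrict (a g) X"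
      using bij_act closed a_comp by (auto simp: BijGroup_def Bij_def compose_def fun_eq_iff)
  qed
  then show ?thesis
    unfolding group_action_def group_hom_def group_hom_axioms_def
    using group_PermGroup[OF pg] group_BijGroup by auto
qed

lemma burnside_num_orbits:
  "num_orbits K a X * card K = (\<Sum>f\<in>K. card {x \<in> X. a f x = x})"
proof -
  have "X // orbit_rel K a X = orbits (PermGroup K) X (\<lambda>f. restrict (a f) X)"
    unfolding quotient_def orbits_def orbit_def orbit_rel_def by (auto simp: image_iff)
  moreover have "invariants X (\<lambda>f. restrict (a f) X) f = {x \<in> X. a f x = x}" for f
    by (auto simp: invariants_def)
  ultimately show ?thesis
    using group_action.burnside[OF group_action_restrict _ finX] finite_perm_group[OF pg finS]
    by (simp add: num_orbits_def Coset.order_def)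
qed

text \<open>An invariant set is a union of orbits in exactly one way, so \<open>Union\<close> is a
  bijection from the sets of orbits onto the invariant sets.\<close>

lemma card_invariant_sets:
  "card {R. R \<subseteq> X \<and> (\<forall>f\<in>K. \<forall>x\<in>X. a f x \<in> R \<longleftrightarrow> x \<in> R)} = 2 ^ num_orbits K a X"
proof -
  let ?r = "orbit_rel K a X"
  note eq = equiv_orbit_rel
  have disj: "C = D" if "C \<in> X // ?r" "D \<in> X // ?r" "x \<in> C" "x \<in> D" for C D x
    using quotient_disj[OF eq that(1,2)] that by auto
  have inj: "inj_on Union (Pow (X // ?r))"
  proof (rule inj_onI)
    have "P \<subseteq> Q" if PQ: "P \<subseteq> X // ?r" "Q \<subseteq> X // ?r" "\<Union>P = \<Union>Q" for P Q
    proof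
      fix C assume C: "C \<in> P"
      then obtain x where x: "x \<in> C" using PQ(1) in_quotient_imp_non_empty[OF eq, of C] by blast
      then obtain D where "D \<in> Q" "x \<in> D" using PQ C by blast
      then show "C \<in> Q" using disj[of C D x] PQ C x by auto
    qed
    then show "P = Q" if "P \<in> Pow (X // ?r)" "Q \<in> Pow (X // ?r)" "\<Union>P = \<Union>Q" for P Q
      using that by (metis PowD subset_antisym)
  qed
  have "Union ` Pow (X // ?r) = {R. R \<subseteq> X \<and> (\<forall>f\<in>K. \<forall>x\<in>X. a f x \<in> R \<longleftrightarrow> x \<in> R)}"
  proof (intro equalityI subsetI)
    fix R assume "R \<in> Union ` Pow (X // ?r)"
    then obtain P where P: "P \<subseteq> X // ?r" and R: "R = \<Union>P" by auto
    have "R \<subseteq> X" using P R in_quotient_imp_subset[OF eq] by blast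
    moreover have "a f x \<in> R \<longleftrightarrow> x \<in> R" if "f \<in> K" "x \<in> X" for f x
    proof -
      have *: "(x, a f x) \<in> ?r" using that by (auto simp: orbit_rel_def)
      then have "(a f x, x) \<in> ?r" using eq by (auto simp: equiv_def dest: symD)
      with * have "x \<in> C \<longleftrightarrow> a f x \<in> C" if "C \<in> P" for C
        using that P in_quotient_imp_closed[OF eq, of C] by blast
      then show ?thesis using R by auto
    qed
    ultimately show "R \<in> {R. R \<subseteq> X \<and> (\<forall>f\<in>K. \<forall>x\<in>X. a f x \<in> R \<longleftrightarrow> x \<in> R)}" by auto
  next
    fix R assume R: "R \<in> {R. R \<subseteq> X \<and> (\<forall>f\<in>K. \<forall>x\<in>X. a f x \<in> R \<longleftrightarrow> x \<in> R)}"
    have "R = \<Union>((\<lambda>x. ?r `` {x}) ` R)"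
    proof (intro equalityI subsetI)
      fix x assume "x \<in> R" then show "x \<in> \<Union>((\<lambda>x. ?r `` {x}) ` R)"
        using R equiv_class_self[OF eq] by blast
    next
      fix x assume "x \<in> \<Union>((\<lambda>x. ?r `` {x}) ` R)"
      then show "x \<in> R" using R by (auto simp: orbit_rel_def)
    qed
    moreover have "(\<lambda>x. ?r `` {x}) ` R \<in> Pow (X // ?r)"
      using R by (auto intro!: quotientI)
    ultimately show "R \<in> Union ` Pow (X // ?r)" by blast
  qed
  then have "card {R. R \<subseteq> X \<and> (\<forall>f\<in>K. \<forall>x\<in>X. a f x \<in> R \<longleftrightarrow> x \<in> R)} = card (Pow (X // ?r))"
    using card_image[OF inj] by simp
  also have "\<dots> = 2 ^ num_orbits K a X"
    unfolding num_orbits_def using finX equiv_type[OF eq] by (intro card_Pow finite_quotient)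
  finally show ?thesis .
qed

text \<open>Each orbit contributes at least 2 to the right-hand side: a fixed point is counted in
  both summands, and any other orbit has at least two elements. Unlike Burnside's formula, this
  needs only the common fixed points of the group.\<close>

lemma twice_num_orbits_le:
  "2 * num_orbits K a X \<le> card X + card {x \<in> X. \<forall>f\<in>K. a f x = x}"
proof -
  let ?r = "orbit_rel K a X" and ?F = "{x \<in> X. \<forall>f\<in>K. a f x = x}"
  note eq = equiv_orbit_rel
  have fq: "finite (X // ?r)" using finX equiv_type[OF eq] by (rule finite_quotient)
  have fin: "finite C" if "C \<in> X // ?r" for C
    using that in_quotient_imp_subset[OF eq] finX finite_subset by metis
  have "card X = (\<Sum>C\<in>X // ?r. card C)"
    using Union_quotient[OF eq] quotient_disj[OF eq] fin
      card_Union_disjoint[of "X // ?r"] by (auto simp: pairwise_def disjnt_def)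
  moreover have "card ?F = (\<Sum>C\<in>X // ?r. card (C \<inter> ?F))"
  proof -
    have "?F = \<Union>((\<lambda>C. C \<inter> ?F) ` (X // ?r))" using Union_quotient[OF eq] by auto
    also have "card \<dots> = (\<Sum>C\<in>X // ?r. card (C \<inter> ?F))"
      using fq fin quotient_disj[OF eq] by (intro card_UN_disjoint) auto
    finally show ?thesis .
  qed
  moreover have "2 \<le> card C + card (C \<inter> ?F)" if C: "C \<in> X // ?r" for C
  proof -
    obtain x where x: "x \<in> C" using in_quotient_imp_non_empty[OF eq C] by blast
    then have xX: "x \<in> X" using C in_quotient_imp_subset[OF eq] by blast
    show ?thesis
    proof (cases "x \<in> ?F")
      case True
      then have "card (C \<inter> ?F) > 0" "card C > 0" using x fin[OF C] by (auto simp: card_gt_0_iff)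
      then show ?thesis by linarith
    next
      case False
      then obtain f where f: "f \<in> K" "a f x \<noteq> x" using xX by auto
      then have "(x, a f x) \<in> ?r" using xX by (auto simp: orbit_rel_def)
      then have "a f x \<in> C" using in_quotient_imp_closed[OF eq C x] by auto
      then have "card {x, a f x} \<le> card C" using x fin[OF C] by (intro card_mono) auto
      then show ?thesis using f(2) by auto
    qed
  qed
  then have "(\<Sum>C\<in>X // ?r. 2) \<le> (\<Sum>C\<in>X // ?r. card C + card (C \<inter> ?F))" by (rule sum_mono)
  ultimately show ?thesis by (simp add: num_orbits_def sum.distrib)
qed

end

lemma
  assumes "perm_action S K a X" "perm_action S' K' a X" "K \<subseteq> K'"
  shows num_orbits_antimono: "num_orbits K' a X \<le> num_orbits K a X"
    and num_orbits_strict_antimono: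
      "f \<in> K' \<Longrightarrow> x \<in> X \<Longrightarrow> (\<And>g. g \<in> K \<Longrightarrow> a f x \<noteq> a g x) \<Longrightarrow> num_orbits K' a X < num_orbits K a X"
proof -
  have sub: "orbit_rel K a X \<subseteq> orbit_rel K' a X" using assms(3) by (auto simp: orbit_rel_def)
  note * = perm_action.equiv_orbit_rel[OF assms(1)] perm_action.equiv_orbit_rel[OF assms(2)] sub
    perm_action.finX[OF assms(1)]
  show "num_orbits K' a X \<le> num_orbits K a X"
    unfolding num_orbits_def by (rule card_quotient_mono[OF *])
  show "num_orbits K' a X < num_orbits K a X"
    if "f \<in> K'" "x \<in> X" "\<And>g. g \<in> K \<Longrightarrow> a f x \<noteq> a g x"
  proof -
    have "(x, a f x) \<in> orbit_rel K' a X" "(x, a f x) \<notin> orbit_rel K a X"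
      using that by (auto simp: orbit_rel_def)
    then show ?thesis unfolding num_orbits_def
      by (intro card_quotient_strict_mono[OF *]) auto
  qed
qed

section \<open>Functions asymptotic to a monomial times a power of two\<close>

text \<open>The factor \<open>m\<close> is the group order in Burnside's lemma. The identity holds
  only eventually because \<open>{1..n}\<close> must first contain the set on which the group
  acts.\<close>

definition quasi_poly :: "(nat \<Rightarrow> nat) \<Rightarrow> bool"
  where "quasi_poly e \<longleftrightarrow> (\<exists>(m::int) (p::int poly). m > 0 \<and>
    (\<forall>\<^sub>F n in sequentially. m * int (e n) = poly p (int n)))"

text \<open>The leading coefficient is a nonzero integer, so a nonconstant polynomial runs away with
  slope at least 1. In the induction the shift \<open>c + 1\<close> guarantees that the inner
  polynomial has absolute value at least 1, so that multiplying it by \<open>n\<close> keeps the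
  linear bound, and the shift \<open>\<bar>a\<bar>\<close> absorbs the constant term.\<close>

lemma int_poly_cases:
  fixes p :: "int poly"
  obtains (const) c where "p = [:c:]"
  | (pos) c where "\<And>n. n \<ge> c \<Longrightarrow> poly p (int n) \<ge> int n - int c"
  | (neg) c where "\<And>n. n \<ge> c \<Longrightarrow> poly p (int n) \<le> int c - int n"
proof -
  have "(\<exists>c. p = [:c:]) \<or> (\<exists>c. \<forall>n\<ge>c. poly p (int n) \<ge> int n - int c) \<or>
    (\<exists>c. \<forall>n\<ge>c. poly p (int n) \<le> int c - int n)"
  proof (induction p)
    case (pCons a p)
    consider c where "p = [:c:]" "c = 0" | c where "p = [:c:]" "c > 0" | c where "p = [:c:]" "c < 0"
      | c where "\<forall>n\<ge>c. poly p (int n) \<ge> int n - int c"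
      | c where "\<forall>n\<ge>c. poly p (int n) \<le> int c - int n"
      using pCons.IH by (metis linorder_neqE_linordered_idom)
    then show ?case
    proof cases
      case (2 c)
      have "poly (pCons a p) (int n) \<ge> int n - int (nat \<bar>a\<bar>)" for n
        using 2 mult_right_mono[of 1 c "int n"] by (auto simp: mult.commute)
      then show ?thesis by blast
    next
      case (3 c)
      have "poly (pCons a p) (int n) \<le> int (nat \<bar>a\<bar>) - int n" for n
        using 3 mult_right_mono[of c "-1" "int n"] by (auto simp: mult.commute)
      then show ?thesis by blast
    next
      case (4 c)
      have "poly (pCons a p) (int n) \<ge> int n - int (nat \<bar>a\<bar> + c + 1)" if "n \<ge> nat \<bar>a\<bar> + c + 1" for n
      proof -
        have "poly p (int n) \<ge> 1" using 4[rule_format, of n] that by auto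
        then have "int n * poly p (int n) \<ge> int n" using mult_left_mono[of 1 "poly p (int n)" "int n"] by simp
        then show ?thesis by auto
      qed
      then show ?thesis by blast
    next
      case (5 c)
      have "poly (pCons a p) (int n) \<le> int (nat \<bar>a\<bar> + c + 1) - int n" if "n \<ge> nat \<bar>a\<bar> + c + 1" for n
      proof -
        have "poly p (int n) \<le> -1" using 5[rule_format, of n] that by auto
        then have "int n * poly p (int n) \<le> - int n" using mult_left_mono[of "poly p (int n)" "-1" "int n"] by simp
        then show ?thesis by auto
      qed
      then show ?thesis by blast
    qed auto
  qed auto
  then show thesis using const pos neg by blast
qed

section \<open>Comparison of growth rates\<close>

definition scale :: "nat \<Rightarrow> (nat \<Rightarrow> nat) \<Rightarrow> nat \<Rightarrow> real"
  where "scale s e n = real n ^ s * 2 ^ e n"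

lemma scale_pos: "n > 0 \<Longrightarrow> scale s e n > 0"
  by (simp add: scale_def)

text \<open>A linear gap between the exponents beats the power of \<open>n\<close> in the
  denominator; the power in the numerator is at least 1 and simply dropped.\<close>

lemma filterlim_scale_ratio:
  fixes m c :: nat
  assumes "m > 0" and "\<forall>\<^sub>F n in sequentially. int m * (int (e n) - int (e' n)) \<ge> int n - int c"
  shows "filterlim (\<lambda>n. scale s e n / scale s' e' n) at_top sequentially"
proof (rule filterlim_at_top_mono)
  define L :: real where "L = 1 / real m"
  have "L > 0" using assms(1) by (simp add: L_def)
  then show "filterlim (\<lambda>n. 2 powr (L * (real n - real c)) / real n ^ s') at_top sequentially"
    by real_asymp
  show "\<forall>\<^sub>F n in sequentially. 2 powr (L * (real n - real c)) / real n ^ s' \<le> scale s e n / scale s' e' n"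
    using assms(2) eventually_gt_at_top[of 0]
  proof eventually_elim
    case (elim n)
    have "real_of_int (int n - int c) \<le> real_of_int (int m * (int (e n) - int (e' n)))"
      using elim(1) by (simp only: of_int_le_iff)
    then have "L * (real n - real c) \<le> real (e n) - real (e' n)"
      using assms(1) by (simp add: L_def field_simps)
    then have "2 powr (L * (real n - real c)) \<le> 2 powr (real (e n) - real (e' n))" by simp
    also have "\<dots> = 2 ^ e n / 2 ^ e' n" by (simp add: powr_diff powr_realpow)
    finally have "2 powr (L * (real n - real c)) / real n ^ s' \<le> 2 ^ e n / 2 ^ e' n / real n ^ s'"
      by (rule divide_right_mono) simp
    also have "\<dots> \<le> (2 ^ e n / 2 ^ e' n / real n ^ s') * real n ^ s"
      using elim(2) mult_left_mono[of 1 "real n ^ s" "2 ^ e n / 2 ^ e' n / real n ^ s'"] by simp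
    also have "\<dots> = scale s e n / scale s' e' n" by (simp add: scale_def field_simps)
    finally show ?case .
  qed
qed

text \<open>After clearing denominators the difference of the exponents is an integer polynomial. If
  it is constant, the powers of \<open>n\<close> decide; otherwise it grows at least linearly in one
  direction and the powers of \<open>n\<close> do not matter.\<close>

lemma scale_cases:
  assumes "quasi_poly e" "quasi_poly e'"
  obtains (rat) q :: real where "q \<in> \<rat>" "q > 0" "(\<lambda>n. scale s e n / scale s' e' n) \<longlonglongrightarrow> q"
  | (top) "filterlim (\<lambda>n. scale s e n / scale s' e' n) at_top sequentially"
  | (bot) "filterlim (\<lambda>n. scale s' e' n / scale s e n) at_top sequentially"
proof -
  obtain m p where m: "m > (0::int)" and p: "\<forall>\<^sub>F n in sequentially. m * int (e n) = poly p (int n)"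
    using assms(1) unfolding quasi_poly_def by blast
  obtain m' p' where m': "m' > (0::int)" and p': "\<forall>\<^sub>F n in sequentially. m' * int (e' n) = poly p' (int n)"
    using assms(2) unfolding quasi_poly_def by blast
  define M where "M = nat (m * m')"
  have M: "M > 0" "int M = m * m'" using m m' by (simp_all add: M_def)
  define P where "P = smult m' p - smult m p'"
  have P: "\<forall>\<^sub>F n in sequentially. int M * (int (e n) - int (e' n)) = poly P (int n)"
    using p p'
  proof eventually_elim
    case (elim n)
    have "int M * (int (e n) - int (e' n)) = m' * (m * int (e n)) - m * (m' * int (e' n))"
      by (simp add: M algebra_simps)
    then show ?case by (simp only: elim P_def poly_diff poly_smult)
  qed
  show thesis
  proof (cases P rule: int_poly_cases)
    case (const c)
    \<comment> \<open>The difference of the exponents is itself an integer, so a constant multiple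
      of it pins it down to an integer \<open>d\<close>. The ratio of the powers of two is therefore
      rational and not merely a root of a power of two.\<close>
    have "\<exists>d::int. \<forall>\<^sub>F n in sequentially. int (e n) - int (e' n) = d"
    proof -
      have "\<forall>\<^sub>F n in sequentially. int (e n) - int (e' n) = c div int M"
        using P by eventually_elim (use const M in auto)
      then show ?thesis ..
    qed
    then obtain d where d: "\<forall>\<^sub>F n in sequentially. int (e n) - int (e' n) = d" ..
    define q where "q = (2::real) powi d"
    have q: "q \<in> \<rat>" "q > 0" by (auto simp: q_def power_int_def)
    have ratio: "\<forall>\<^sub>F n in sequentially. scale s e n / scale s' e' n = q * (real n ^ s / real n ^ s')"
      using d
    proof eventually_elim
      case (elim n)
      have "2 ^ e n / 2 ^ e' n = q"
        unfolding q_def elim[symmetric] by (simp add: power_int_diff)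
      then show ?case by (simp add: scale_def field_simps)
    qed
    have ratio': "\<forall>\<^sub>F n in sequentially. scale s' e' n / scale s e n = inverse q * (real n ^ s' / real n ^ s)"
      using ratio
    proof eventually_elim
      case (elim n)
      have "scale s' e' n / scale s e n = inverse (scale s e n / scale s' e' n)" by simp
      then show ?case unfolding elim by (simp add: field_simps)
    qed
    have tp: "filterlim (\<lambda>n. r * (real n ^ i / real n ^ j)) at_top sequentially" if "i > j" "r > 0" for i j r
    proof -
      have "filterlim (\<lambda>n. r * real n ^ (i - j)) at_top sequentially"
        using that
        by (intro filterlim_tendsto_pos_mult_at_top[OF tendsto_const] filterlim_pow_at_top filterlim_real_sequentially) simp_all
      moreover have eq: "\<forall>\<^sub>F n in sequentially. r * real n ^ (i - j) = r * (real n ^ i / real n ^ j)"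
        using eventually_gt_at_top[of 0] by eventually_elim (use that in \<open>simp add: power_diff\<close>)
      ultimately show ?thesis using filterlim_cong[OF refl refl eq] by simp
    qed
    consider "s = s'" | "s > s'" | "s < s'" by linarith
    then show thesis
    proof cases
      case 1
      have "\<forall>\<^sub>F n in sequentially. scale s e n / scale s' e' n = q"
        using ratio eventually_gt_at_top[of 0] by eventually_elim (simp add: 1)
      then have "(\<lambda>n. scale s e n / scale s' e' n) \<longlonglongrightarrow> q" by (rule tendsto_eventually)
      then show thesis using rat q by blast
    next
      case 2
      then have "filterlim (\<lambda>n. scale s e n / scale s' e' n) at_top sequentially"
        using tp[of s' s q] q filterlim_cong[OF refl refl ratio] by simp
      then show thesis by (rule top)
    next
      case 3
      then have "filterlim (\<lambda>n. scale s' e' n / scale s e n) at_top sequentially"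
        using tp[of s s' "inverse q"] q filterlim_cong[OF refl refl ratio'] by simp
      then show thesis by (rule bot)
    qed
  next
    case (pos c)
    have "\<forall>\<^sub>F n in sequentially. int M * (int (e n) - int (e' n)) \<ge> int n - int c"
      using P eventually_ge_at_top[of c] by eventually_elim (use pos in auto)
    then show thesis using filterlim_scale_ratio[OF M(1)] top by blast
  next
    case (neg c)
    have "\<forall>\<^sub>F n in sequentially. int M * (int (e' n) - int (e n)) \<ge> int n - int c"
      using P eventually_ge_at_top[of c]
    proof eventually_elim
      case (elim n)
      then show ?case using neg[of n] by (simp add: algebra_simps)
    qed
    then show thesis using filterlim_scale_ratio[OF M(1)] bot by blast
  qed
qed

text \<open>The class to which all counting functions will belong: it is closed under finite
  nonempty sums and asymptotic equivalence, and the quotient of any two members has a limit of the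
  required kind. Positivity of \<open>c\<close> rules out cancellation and makes denominators
  eventually nonzero.\<close>

definition scaled :: "(nat \<Rightarrow> real) \<Rightarrow> bool"
  where "scaled f \<longleftrightarrow> (\<exists>c s e. c \<in> \<rat> \<and> c > 0 \<and> quasi_poly e \<and> (\<lambda>n. f n / scale s e n) \<longlonglongrightarrow> c)"

lemma scaledI: "c \<in> \<rat> \<Longrightarrow> c > 0 \<Longrightarrow> quasi_poly e \<Longrightarrow> (\<lambda>n. f n / scale s e n) \<longlonglongrightarrow> c \<Longrightarrow> scaled f"
  unfolding scaled_def by blast

lemma tendsto_div_scale_change:
  assumes "(\<lambda>n. f n / scale s e n) \<longlonglongrightarrow> c" "(\<lambda>n. scale s e n / scale s' e' n) \<longlonglongrightarrow> q"
  shows "(\<lambda>n. f n / scale s' e' n) \<longlonglongrightarrow> c * q"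
proof -
  have "(\<lambda>n. (f n / scale s e n) * (scale s e n / scale s' e' n)) \<longlonglongrightarrow> c * q"
    by (intro tendsto_mult assms)
  moreover have "\<forall>\<^sub>F n in sequentially. (f n / scale s e n) * (scale s e n / scale s' e' n) = f n / scale s' e' n"
    using eventually_gt_at_top[of 0]
  proof eventually_elim
    case (elim n)
    then show ?case using scale_pos[of n s e] by simp
  qed
  ultimately show ?thesis by (rule Lim_transform_eventually)
qed

lemma scale_ratio_zero:
  assumes "filterlim (\<lambda>n. scale s e n / scale s' e' n) at_top sequentially"
  shows "(\<lambda>n. scale s' e' n / scale s e n) \<longlonglongrightarrow> 0"
proof -
  have "(\<lambda>n. inverse (scale s e n / scale s' e' n)) \<longlonglongrightarrow> 0"
    by (rule tendsto_inverse_0_at_top[OF assms])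
  then show ?thesis by simp
qed

text \<open>Either the two scales have a positive rational ratio in the limit and the constants
  combine, or one scale dominates and the other summand disappears.\<close>

lemma scaled_add:
  assumes "scaled f" "scaled g"
  shows "scaled (\<lambda>n. f n + g n)"
proof -
  obtain c s e where f: "c \<in> \<rat>" "c > 0" "quasi_poly e" "(\<lambda>n. f n / scale s e n) \<longlonglongrightarrow> c"
    using assms(1) unfolding scaled_def by blast
  obtain c' s' e' where g: "c' \<in> \<rat>" "c' > 0" "quasi_poly e'" "(\<lambda>n. g n / scale s' e' n) \<longlonglongrightarrow> c'"
    using assms(2) unfolding scaled_def by blast
  show ?thesis
  using f(3) g(3)
  proof (cases rule: scale_cases[where s = s and s' = s'])
    case (rat q)
    have "(\<lambda>n. f n / scale s' e' n + g n / scale s' e' n) \<longlonglongrightarrow> c * q + c'"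
      by (intro tendsto_add tendsto_div_scale_change[OF f(4)] rat g)
    then show ?thesis
      using f g rat by (intro scaledI[of "c * q + c'" e' _ s']) (auto simp: add_divide_distrib add_pos_pos)
  next
    case top
    have "(\<lambda>n. f n / scale s e n + g n / scale s e n) \<longlonglongrightarrow> c + c' * 0"
      by (intro tendsto_add tendsto_div_scale_change[OF g(4)] scale_ratio_zero[OF top] f)
    then show ?thesis
      using f g by (intro scaledI[of c e _ s]) (auto simp: add_divide_distrib)
  next
    case bot
    have "(\<lambda>n. f n / scale s' e' n + g n / scale s' e' n) \<longlonglongrightarrow> c * 0 + c'"
      by (intro tendsto_add tendsto_div_scale_change[OF f(4)] scale_ratio_zero[OF bot] g)
    then show ?thesis
      using f g by (intro scaledI[of c' e' _ s']) (auto simp: add_divide_distrib)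
  qed
qed

lemma scaled_sum:
  assumes "finite A" "A \<noteq> {}" "\<And>x. x \<in> A \<Longrightarrow> scaled (f x)"
  shows "scaled (\<lambda>n. \<Sum>x\<in>A. f x n)"
  using assms by (induction rule: finite_ne_induct) (auto intro: scaled_add)

lemma scaled_eventually_pos:
  assumes "scaled f" shows "\<forall>\<^sub>F n in sequentially. f n > 0"
proof -
  obtain c s e where f: "c > 0" "(\<lambda>n. f n / scale s e n) \<longlonglongrightarrow> c"
    using assms unfolding scaled_def by blast
  have "\<forall>\<^sub>F n in sequentially. f n / scale s e n > 0" by (rule order_tendstoD(1)[OF f(2,1)])
  then show ?thesis
    using eventually_gt_at_top[of 0]
  proof eventually_elim
    case (elim n)
    then show ?case using scale_pos[of n s e] by (simp add: zero_less_divide_iff)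
  qed
qed

lemma scaled_asymp_equiv:
  assumes "scaled f" "(\<lambda>n. (g n - f n) / f n) \<longlonglongrightarrow> 0"
  shows "scaled g"
proof -
  obtain c s e where f: "c \<in> \<rat>" "c > 0" "quasi_poly e" "(\<lambda>n. f n / scale s e n) \<longlonglongrightarrow> c"
    using assms(1) unfolding scaled_def by blast
  have "(\<lambda>n. f n / scale s e n + (f n / scale s e n) * ((g n - f n) / f n)) \<longlonglongrightarrow> c + c * 0"
    by (intro tendsto_add tendsto_mult f assms)
  moreover have "\<forall>\<^sub>F n in sequentially.
      f n / scale s e n + (f n / scale s e n) * ((g n - f n) / f n) = g n / scale s e n"
    using scaled_eventually_pos[OF assms(1)]
    by eventually_elim (simp add: diff_divide_distrib right_diff_distrib)
  ultimately have "(\<lambda>n. g n / scale s e n) \<longlonglongrightarrow> c + c * 0" by (rule Lim_transform_eventually)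
  then show ?thesis using f by (intro scaledI[of c e _ s]) auto
qed

lemma tendsto_binomial_div_power: "(\<lambda>n. real (n choose k) / real n ^ k) \<longlonglongrightarrow> 1 / fact k"
proof (induction k)
  case (Suc k)
  have "(\<lambda>n. (real (n choose k) / real n ^ k) * ((real n - real k) / real n / real (Suc k)))
      \<longlonglongrightarrow> 1 / fact k * (1 / real (Suc k))"
    by (intro tendsto_mult Suc.IH tendsto_divide tendsto_const) (real_asymp | simp)+
  moreover have "\<forall>\<^sub>F n in sequentially. (real (n choose k) / real n ^ k) * ((real n - real k) / real n / real (Suc k))
      = real (n choose Suc k) / real n ^ Suc k"
    using eventually_ge_at_top[of "Suc k"]
  proof eventually_elim
    case (elim n)
    have "Suc k * (n choose Suc k) = (n choose k) * (n - k)"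
      using binomial_absorb_comp[of n k] binomial_absorption[of k n] by (simp add: mult.commute)
    then have "real (Suc k) * real (n choose Suc k) = real (n choose k) * (real n - real k)"
      using elim by (metis of_nat_diff of_nat_mult Suc_leD)
    then have "real (n choose Suc k) = real (n choose k) * (real n - real k) / real (Suc k)"
      by (simp add: field_simps del: of_nat_Suc)
    then show ?case using elim by (simp add: ac_simps del: of_nat_Suc)
  qed
  ultimately have "(\<lambda>n. real (n choose Suc k) / real n ^ Suc k) \<longlonglongrightarrow> 1 / fact k * (1 / real (Suc k))"
    by (rule Lim_transform_eventually)
  then show ?case by (simp add: field_simps)
qed simp

text \<open>The binomial coefficient will count the possible supports of size \<open>k\<close>; it
  turns into the power \<open>n ^ k\<close> of the scale and the rational factor
  \<open>1 / fact k\<close>.\<close>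

lemma scaled_binomial_mult:
  assumes "(\<lambda>n. f n / 2 ^ e n) \<longlonglongrightarrow> c" "c \<in> \<rat>" "c > 0" "quasi_poly e"
  shows "scaled (\<lambda>n. real (n choose k) * f n)"
proof (rule scaledI)
  have "(\<lambda>n. (real (n choose k) / real n ^ k) * (f n / 2 ^ e n)) \<longlonglongrightarrow> 1 / fact k * c"
    by (intro tendsto_mult tendsto_binomial_div_power assms)
  then show "(\<lambda>n. real (n choose k) * f n / scale k e n) \<longlonglongrightarrow> 1 / fact k * c"
    by (simp add: scale_def)
  have "1 / fact k = 1 / real (fact k)" by simp
  then have "1 / (fact k::real) \<in> \<rat>" by (metis Rats_1 Rats_divide Rats_of_nat)
  then show "1 / fact k * c \<in> \<rat>" using assms(2) by (rule Rats_mult)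
qed (use assms in auto)

text \<open>With both powers of \<open>n\<close> equal to 1, \<open>scale_cases\<close> speaks about
  the powers of two alone, and divergence is excluded because the ratio stays at most 1.\<close>

lemma rational_limit_power_diff:
  assumes "quasi_poly e" "quasi_poly e'" "\<forall>\<^sub>F n in sequentially. e n \<le> e' n"
  shows "\<exists>q\<in>\<rat>. (\<lambda>n. (2::real) ^ e n / 2 ^ e' n) \<longlonglongrightarrow> q"
using assms(1,2)
proof (cases rule: scale_cases[where s = 0 and s' = 0])
  case (rat q)
  then show ?thesis by (auto simp: scale_def)
next
  case top
  have "\<forall>\<^sub>F n in sequentially. scale 0 e n / scale 0 e' n > 1"
    using top by (simp add: filterlim_at_top_dense)
  with assms(3) have "\<forall>\<^sub>F n in sequentially. False"
    by eventually_elim (simp add: scale_def field_simps)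
  then show ?thesis by simp
next
  case bot
  then show ?thesis using scale_ratio_zero[OF bot] by (intro bexI[of _ 0]) (auto simp: scale_def)
qed

lemma scaled_quotient_limit_exists:
  assumes "scaled (\<lambda>n. real (a n))" "scaled (\<lambda>n. real (b n))"
  shows "quotient_limit_exists a b"
proof -
  obtain c s e where f: "c \<in> \<rat>" "c > 0" "quasi_poly e" "(\<lambda>n. real (a n) / scale s e n) \<longlonglongrightarrow> c"
    using assms(1) unfolding scaled_def by blast
  obtain c' s' e' where g: "c' \<in> \<rat>" "c' > 0" "quasi_poly e'" "(\<lambda>n. real (b n) / scale s' e' n) \<longlonglongrightarrow> c'"
    using assms(2) unfolding scaled_def by blast
  have ne: "\<forall>\<^sub>F n in sequentially. b n \<noteq> 0"
    using scaled_eventually_pos[OF assms(2)] by eventually_elim simp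
  have cc: "(\<lambda>n. (real (a n) / scale s e n) / (real (b n) / scale s' e' n)) \<longlonglongrightarrow> c / c'"
    using g by (intro tendsto_divide f g) auto
  have eq: "\<forall>\<^sub>F n in sequentially. ((real (a n) / scale s e n) / (real (b n) / scale s' e' n))
      * (scale s e n / scale s' e' n) = real (a n) / real (b n)"
    using eventually_gt_at_top[of 0]
  proof eventually_elim
    case (elim n)
    then show ?case using scale_pos[of n s e] scale_pos[of n s' e'] by simp
  qed
  have "\<exists>L \<in> ereal ` \<rat> \<union> {\<infinity>}. (\<lambda>n. ereal (real (a n) / real (b n))) \<longlonglongrightarrow> L"
  using f(3) g(3)
  proof (cases rule: scale_cases[where s = s and s' = s'])
    case (rat q)
    have "(\<lambda>n. real (a n) / real (b n)) \<longlonglongrightarrow> c / c' * q"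
      by (rule Lim_transform_eventually[OF tendsto_mult[OF cc rat(3)] eq])
    moreover have "c / c' * q \<in> \<rat>" using f g rat by auto
    ultimately show ?thesis by (intro bexI[of _ "ereal (c / c' * q)"]) auto
  next
    case top
    have "filterlim (\<lambda>n. ((real (a n) / scale s e n) / (real (b n) / scale s' e' n))
      * (scale s e n / scale s' e' n)) at_top sequentially"
      by (rule filterlim_tendsto_pos_mult_at_top[OF cc _ top]) (use f g in auto)
    then have "filterlim (\<lambda>n. real (a n) / real (b n)) at_top sequentially"
      using filterlim_cong[OF refl refl eq] by blast
    then show ?thesis by (intro bexI[of _ "\<infinity>"]) (auto simp: tendsto_PInfty_eq_at_top)
  next
    case bot
    have "(\<lambda>n. real (a n) / real (b n)) \<longlonglongrightarrow> c / c' * 0"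
      by (rule Lim_transform_eventually[OF tendsto_mult[OF cc scale_ratio_zero[OF bot]] eq])
    then show ?thesis by (intro bexI[of _ "ereal 0"]) auto
  qed
  then show ?thesis using ne unfolding quotient_limit_exists_def by blast
qed

section \<open>Structures as sets of cells\<close>

definition act :: "(nat \<Rightarrow> nat) \<Rightarrow> nat \<times> nat list \<Rightarrow> nat \<times> nat list"
  where "act f x = (fst x, map f (snd x))"

definition moved :: "('v \<Rightarrow> 'v) \<Rightarrow> 'v set"
  where "moved f = {x. f x \<noteq> x}"

definition support :: "('v \<Rightarrow> 'v) set \<Rightarrow> 'v set"
  where "support K = (\<Union>f\<in>K. moved f)"

text \<open>
  The average number of points moved by an element of \<open>K\<close>; by Burnside's lemma this is
  the (integral) difference between the number of points and the number of orbits.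
\<close>
definition defect :: "('v \<Rightarrow> 'v) set \<Rightarrow> nat"
  where "defect K = (\<Sum>f\<in>K. card (moved f)) div card K"

lemma moved_subset: "f permutes S \<Longrightarrow> moved f \<subseteq> S"
  by (auto simp: moved_def permutes_def)

lemma permutes_iff_moved: "f permutes T \<Longrightarrow> f permutes S \<longleftrightarrow> moved f \<subseteq> S"
  using permutes_superset[of f T S] by (auto simp: moved_def permutes_def)

lemma support_subset: "perm_group S K \<Longrightarrow> support K \<subseteq> S"
  using moved_subset perm_groupD(1) unfolding support_def by blast

lemma perm_action_app:
  assumes "perm_group S K" "S \<subseteq> A" "finite A"
  shows "perm_action S K (\<lambda>f. f) A"
proof
  show "f x \<in> A" if "f \<in> K" "x \<in> A" for f x
    using that assms perm_groupD(1)[OF assms(1), of f] by (metis permutes_in_image permutes_subset)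
qed (use assms finite_subset in auto)

text \<open>Every point is either fixed or moved by \<open>f\<close>; summing over \<open>K\<close>
  and applying Burnside's lemma to the fixed points gives both claims. Enlarging \<open>A\<close>
  adds as many orbits as points, which is why \<open>defect\<close> needs no reference to
  \<open>A\<close>.\<close>

lemma
  assumes K: "perm_group S K" "S \<subseteq> A" "finite A"
  shows num_orbits_defect: "num_orbits K (\<lambda>f. f) A + defect K = card A"
    and defect_card: "defect K * card K = (\<Sum>f\<in>K. card (moved f))"
proof -
  have pos: "card K > 0" using perm_group_card_pos[OF K(1)] K finite_subset by blast
  have fixd: "card {x \<in> A. f x = x} + card (moved f) = card A" if "f \<in> K" for f
  proof -
    have "moved f \<subseteq> A" using moved_subset perm_groupD(1)[OF K(1) that] K by blast
    then have "card (moved f) = card A - card {x \<in> A. f x = x}"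
      using K(3) by (subst card_Diff_subset[symmetric]) (auto simp: moved_def intro!: arg_cong[of _ _ card])
    then show ?thesis using card_mono[of A "{x \<in> A. f x = x}"] K(3) by auto
  qed
  have "num_orbits K (\<lambda>f. f) A * card K + (\<Sum>f\<in>K. card (moved f)) = (\<Sum>f\<in>K. card A)"
    unfolding perm_action.burnside_num_orbits[OF perm_action_app[OF K]] sum.distrib[symmetric]
    by (rule sum.cong) (simp_all add: fixd)
  then have eq: "num_orbits K (\<lambda>f. f) A * card K + (\<Sum>f\<in>K. card (moved f)) = card A * card K" by simp
  then have "(\<Sum>f\<in>K. card (moved f)) = (card A - num_orbits K (\<lambda>f. f) A) * card K"
    by (simp add: diff_mult_distrib)
  moreover have "num_orbits K (\<lambda>f. f) A \<le> card A"
    using eq pos by (metis le_add1 mult_le_cancel2)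
  ultimately show "num_orbits K (\<lambda>f. f) A + defect K = card A"
    and "defect K * card K = (\<Sum>f\<in>K. card (moved f))"
    using pos by (simp_all add: defect_def)
qed

text \<open>A larger group with the same orbits has the same defect, so a proper inclusion is not
  enough: \<open>g\<close> must take some point out of its \<open>K\<close>-orbit.\<close>

lemma defect_strict_mono:
  assumes "perm_group S K" "perm_group S K'" "finite S" "K \<subseteq> K'"
    and "g \<in> K'" "x \<in> S" "\<And>f. f \<in> K \<Longrightarrow> g x \<noteq> f x"
  shows "defect K < defect K'"
proof -
  note a = perm_action_app[OF assms(1) subset_refl assms(3)] perm_action_app[OF assms(2) subset_refl assms(3)]
  note d = num_orbits_defect[OF assms(1) subset_refl assms(3)] num_orbits_defect[OF assms(2) subset_refl assms(3)]
  have "num_orbits K' (\<lambda>f. f) S < num_orbits K (\<lambda>f. f) S"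
    using num_orbits_strict_antimono[OF a assms(4), of g x] assms(5-7) by blast
  then show ?thesis using d by linarith
qed

text \<open>The support consists of the orbits with at least two points, and an orbit of size
  \<open>c\<close> contributes \<open>c - 1\<close>, hence at least \<open>c / 2\<close>, to the
  defect.\<close>

lemma card_support_le:
  assumes "perm_group S K" "finite S"
  shows "card (support K) \<le> 2 * defect K"
proof -
  have *: "{x \<in> S. \<forall>f\<in>K. f x = x} = S - support K" by (auto simp: support_def moved_def)
  have "card (S - support K) = card S - card (support K)"
    using assms support_subset finite_subset by (metis card_Diff_subset)
  moreover have "card (support K) \<le> card S"
    using assms support_subset by (metis card_mono)
  moreover have "2 * num_orbits K (\<lambda>f. f) S \<le> card S + card (S - support K)"
    using perm_action.twice_num_orbits_le[OF perm_action_app[OF assms(1) subset_refl assms(2)]]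
    by (simp add: *)
  ultimately show ?thesis using num_orbits_defect[OF assms(1) subset_refl assms(2)] by linarith
qed

section \<open>Cells, stabilizers and the exponent of a permutation group\<close>

locale vocabulary =
  fixes \<rho> :: nat and ar :: "nat \<Rightarrow> nat"
begin

text \<open>
  A structure with universe \<open>{1..n}\<close> is the same thing as a subset of \<open>cells n\<close>, and then
  \<open>stab n S R\<close> consists of its automorphisms moving only points of \<open>S\<close>.
\<close>
definition cells :: "nat \<Rightarrow> (nat \<times> nat list) set"
  where "cells n = (SIGMA i:{1..\<rho>}. tuples (ar i) {1..n})"

definition stab :: "nat \<Rightarrow> nat set \<Rightarrow> (nat \<times> nat list) set \<Rightarrow> (nat \<Rightarrow> nat) set"
  where "stab n S R = {f. f permutes S \<and> (\<forall>x\<in>cells n. act f x \<in> R \<longleftrightarrow> x \<in> R)}"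

definition expo :: "(nat \<Rightarrow> nat) set \<Rightarrow> nat \<Rightarrow> nat"
  where "expo K n = num_orbits K act (cells n)"

lemma finite_cells: "finite (cells n)"
  by (auto simp: cells_def finite_tuples)

lemma card_tuples: "finite A \<Longrightarrow> card (tuples k A) = card A ^ k"
  using card_lists_length_eq[of A k] by (simp add: tuples_def conj_commute)

lemma card_cells: "card (cells n) = (\<Sum>i\<in>{1..\<rho>}. n ^ ar i)"
  by (simp add: cells_def finite_tuples card_tuples)

lemma cells_mono: "m \<le> n \<Longrightarrow> cells m \<subseteq> cells n"
  by (auto simp: cells_def tuples_def)

lemma act_in_cells_iff: "f permutes S \<Longrightarrow> S \<subseteq> {1..n} \<Longrightarrow> act f x \<in> cells n \<longleftrightarrow> x \<in> cells n"
  using permutes_in_image[OF permutes_subset[of f S "{1..n}"]]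
  by (cases x) (auto simp: cells_def act_def tuples_def subset_iff simp del: atLeastAtMost_iff)

lemma act_id [simp]: "act id x = x"
  by (simp add: act_def)

lemma act_comp: "act (f \<circ> g) x = act f (act g x)"
  by (simp add: act_def)

lemma perm_action_act:
  assumes "perm_group S K" "S \<subseteq> {1..n}"
  shows "perm_action S K act (cells n)"
proof
  show "act f x \<in> cells n" if "f \<in> K" "x \<in> cells n" for f x
    using that assms perm_groupD(1) act_in_cells_iff by blast
qed (use assms finite_subset in \<open>auto simp: finite_cells act_comp\<close>)

lemma stab_inv: 
  assumes "f \<in> stab n S R" "S \<subseteq> {1..n}"
  shows "perm_inv f \<in> stab n S R"
proof -
  have f: "f permutes S" using assms by (simp add: stab_def)
  have "act (perm_inv f) x \<in> R \<longleftrightarrow> x \<in> R" if "x \<in> cells n" for x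
  proof -
    have "act (perm_inv f) x \<in> cells n"
      using that act_in_cells_iff[OF permutes_inv[OF f] assms(2)] by simp
    then have "act f (act (perm_inv f) x) \<in> R \<longleftrightarrow> act (perm_inv f) x \<in> R"
      using assms(1) by (simp add: stab_def)
    then show ?thesis using permutes_inv_o(1)[OF f] by (simp flip: act_comp)
  qed
  then show ?thesis using f by (simp add: stab_def permutes_inv)
qed

lemma perm_group_stab:
  assumes "S \<subseteq> {1..n}" shows "perm_group S (stab n S R)"
  unfolding perm_group_def
proof (intro conjI ballI)
  show "f \<circ> g \<in> stab n S R" if "f \<in> stab n S R" "g \<in> stab n S R" for f g
    using that act_in_cells_iff[OF _ assms] by (auto simp: stab_def act_comp permutes_compose)
qed (use assms stab_inv in \<open>auto simp: stab_def permutes_id\<close>)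

lemma stab_subset: "S \<subseteq> T \<Longrightarrow> stab n S R \<subseteq> stab n T R"
  by (auto simp: stab_def intro: permutes_subset)

lemma stab_eq_if_support:
  assumes "support (stab n T R) \<subseteq> S" "S \<subseteq> T"
  shows "stab n S R = stab n T R"
proof
  show "stab n T R \<subseteq> stab n S R"
  proof
    fix f assume f: "f \<in> stab n T R"
    then have "moved f \<subseteq> S" using assms(1) by (auto simp: support_def)
    then show "f \<in> stab n S R" using f permutes_iff_moved[of f T S] by (simp add: stab_def)
  qed
qed (rule stab_subset[OF assms(2)])

lemma card_invariant:
  assumes "perm_group S K" "S \<subseteq> {1..n}"
  shows "card {R. R \<subseteq> cells n \<and> K \<subseteq> stab n S R} = 2 ^ expo K n"
proof -
  have "K \<subseteq> stab n S R \<longleftrightarrow> (\<forall>f\<in>K. \<forall>x\<in>cells n. act f x \<in> R \<longleftrightarrow> x \<in> R)" for R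
    using perm_groupD(1)[OF assms(1)] by (auto simp: stab_def)
  then show ?thesis
    using perm_action.card_invariant_sets[OF perm_action_act[OF assms]] by (simp add: expo_def)
qed

text \<open>A tuple is fixed exactly if none of its entries is moved.\<close>

lemma card_fixed_cells:
  assumes "f permutes S" "S \<subseteq> {1..n}"
  shows "card {x \<in> cells n. act f x = x} = (\<Sum>i\<in>{1..\<rho>}. (n - card (moved f)) ^ ar i)"
proof -
  have sub: "moved f \<subseteq> {1..n}" using moved_subset[OF assms(1)] assms(2) by blast
  have fixl: "map f xs = xs \<longleftrightarrow> set xs \<inter> moved f = {}" for xs
    by (induction xs) (auto simp: moved_def)
  have "{x \<in> cells n. act f x = x} = (SIGMA i:{1..\<rho>}. tuples (ar i) ({1..n} - moved f))"
    by (auto simp: cells_def act_def tuples_def fixl)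
  moreover have "card ({1..n} - moved f) = n - card (moved f)"
    using sub finite_subset by (subst card_Diff_subset) auto
  ultimately show ?thesis by (simp add: finite_tuples card_tuples)
qed

lemma expo_burnside:
  assumes "perm_group S K" "S \<subseteq> {1..n}"
  shows "expo K n * card K = (\<Sum>f\<in>K. \<Sum>i\<in>{1..\<rho>}. (n - card (moved f)) ^ ar i)"
  unfolding expo_def perm_action.burnside_num_orbits[OF perm_action_act[OF assms]]
  using card_fixed_cells perm_groupD(1)[OF assms(1)] assms(2) by (intro sum.cong) auto

lemma eventually_subset: "S \<subseteq> {1..N} \<Longrightarrow> \<forall>\<^sub>F n in sequentially. S \<subseteq> {1..n}"
  by (rule eventually_mono[OF eventually_ge_at_top[of N]]) (auto intro: order_trans)

lemma quasi_poly_expo: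
  assumes "perm_group S K" "S \<subseteq> {1..N}"
  shows "quasi_poly (expo K)"
  unfolding quasi_poly_def
proof (intro exI conjI)
  have "finite S" using assms(2) finite_subset by blast
  then show "int (card K) > 0" using perm_group_card_pos[OF assms(1)] by simp
  let ?p = "\<Sum>f\<in>K. \<Sum>i\<in>{1..\<rho>}. [:- int (card (moved f)), 1:] ^ ar i"
  show "\<forall>\<^sub>F n in sequentially. int (card K) * int (expo K n) = poly ?p (int n)"
    using eventually_subset[OF assms(2)]
  proof eventually_elim
    case (elim n)
    \<comment> \<open>Only under this bound does the truncated subtraction
      \<open>n - card (moved f)\<close> agree with the value of the linear polynomial.\<close>
    have "card (moved f) \<le> n" if "f \<in> K" for f
      using card_mono[of "{1..n}" "moved f"] moved_subset[OF perm_groupD(1)[OF assms(1) that]] elim by auto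
    then have "int (\<Sum>f\<in>K. \<Sum>i\<in>{1..\<rho>}. (n - card (moved f)) ^ ar i) = poly ?p (int n)"
      by (simp add: poly_sum of_nat_diff)
    then show ?case using expo_burnside[OF assms(1) elim]
      by (metis mult.commute of_nat_mult)
  qed
qed

lemma expo_antimono:
  assumes "perm_group S K" "perm_group S K'" "K \<subseteq> K'" "S \<subseteq> {1..n}"
  shows "expo K' n \<le> expo K n"
  unfolding expo_def
  by (rule num_orbits_antimono[OF perm_action_act[OF assms(1,4)] perm_action_act[OF assms(2,4)] assms(3)])

section \<open>Structures with a prescribed stabilizer\<close>

definition exact :: "nat \<Rightarrow> nat set \<Rightarrow> (nat \<Rightarrow> nat) set \<Rightarrow> (nat \<times> nat list) set set"
  where "exact n S K = {R. R \<subseteq> cells n \<and> stab n S R = K}"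

lemma finite_exact: "finite (exact n S K)"
  by (rule finite_subset[of _ "Pow (cells n)"]) (auto simp: exact_def finite_cells)

lemma finite_perm_groups: "finite S \<Longrightarrow> finite {K. perm_group S K}"
  by (rule finite_subset[of _ "Pow {f. f permutes S}"]) (auto simp: perm_group_def finite_permutations)

text \<open>The \<open>K\<close>-invariant structures are sorted by their stabilizer over
  \<open>S\<close>, which is a group containing \<open>K\<close>. The index set depends on
  \<open>S\<close> but not on \<open>n\<close>, so the recursion survives the passage to the
  limit.\<close>

lemma card_exact:
  assumes "perm_group S K" "S \<subseteq> {1..n}"
  shows "card (exact n S K) + (\<Sum>K'\<in>{K'. perm_group S K' \<and> K \<subset> K'}. card (exact n S K')) = 2 ^ expo K n"
proof -
  let ?Q = "{K'. perm_group S K' \<and> K \<subset> K'}"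
  have finS: "finite S" using assms(2) finite_subset by blast
  have fin: "finite ?Q" using finite_perm_groups[OF finS] by (rule rev_finite_subset) auto
  have "{R. R \<subseteq> cells n \<and> K \<subseteq> stab n S R} = exact n S K \<union> (\<Union>K'\<in>?Q. exact n S K')"
    using perm_group_stab[OF assms(2)] by (auto simp: exact_def)
  moreover have "card (\<Union>K'\<in>?Q. exact n S K') = (\<Sum>K'\<in>?Q. card (exact n S K'))"
    using fin finite_exact by (intro card_UN_disjoint) (auto simp: exact_def)
  moreover have "card (exact n S K \<union> (\<Union>K'\<in>?Q. exact n S K')) = card (exact n S K) + card (\<Union>K'\<in>?Q. exact n S K')"
    using fin finite_exact by (intro card_Un_disjoint) (auto simp: exact_def)
  ultimately show ?thesis using card_invariant[OF assms] by simp
qed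

text \<open>An overgroup has an exponent at most that of \<open>K\<close>, so its share of the
  \<open>K\<close>-invariant structures tends to a rational number; what is left of 1 is the share
  of \<open>K\<close>. The limit may be 0, namely for groups that are not stabilizers.\<close>

lemma exact_limit:
  assumes "perm_group S K" "S \<subseteq> {1..N}"
  shows "\<exists>q\<in>\<rat>. (\<lambda>n. real (card (exact n S K)) / 2 ^ expo K n) \<longlonglongrightarrow> q"
  using assms(1)
proof (induction "card {f. f permutes S} - card K" arbitrary: K rule: less_induct)
  case less
  let ?Q = "{K'. perm_group S K' \<and> K \<subset> K'}"
  have finS: "finite S" using assms(2) finite_subset by blast
  have fin: "finite ?Q" using finite_perm_groups[OF finS] by (rule rev_finite_subset) auto
  have "\<exists>q\<in>\<rat>. (\<lambda>n. real (card (exact n S K')) / 2 ^ expo K n) \<longlonglongrightarrow> q" if K': "K' \<in> ?Q" for K'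
  proof -
    have "K' \<subseteq> {f. f permutes S}" using K' perm_groupD(1) by blast
    then have "card K' \<le> card {f. f permutes S}"
      by (intro card_mono finite_permutations finS)
    moreover have "card K < card K'"
      using K' finite_perm_group[OF _ finS] by (intro psubset_card_mono) auto
    ultimately have "card {f. f permutes S} - card K' < card {f. f permutes S} - card K" by linarith
    then obtain q where q: "q \<in> \<rat>" "(\<lambda>n. real (card (exact n S K')) / 2 ^ expo K' n) \<longlonglongrightarrow> q"
      using less.hyps[of K'] K' by blast
    have "\<forall>\<^sub>F n in sequentially. expo K' n \<le> expo K n"
      using eventually_subset[OF assms(2)]
      by eventually_elim (use less.prems K' expo_antimono in auto)
    then obtain q' where q': "q' \<in> \<rat>" "(\<lambda>n. (2::real) ^ expo K' n / 2 ^ expo K n) \<longlonglongrightarrow> q'"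
      using rational_limit_power_diff quasi_poly_expo[OF _ assms(2)] less.prems K' by blast
    have "(\<lambda>n. (real (card (exact n S K')) / 2 ^ expo K' n) * (2 ^ expo K' n / 2 ^ expo K n)) \<longlonglongrightarrow> q * q'"
      by (intro tendsto_mult q q')
    then show ?thesis using q q' by (intro bexI[of _ "q * q'"]) auto
  qed
  then have "\<forall>K'\<in>?Q. \<exists>q. q \<in> \<rat> \<and> (\<lambda>n. real (card (exact n S K')) / 2 ^ expo K n) \<longlonglongrightarrow> q" by blast
  from bchoice[OF this] obtain q where q: "\<And>K'. K' \<in> ?Q \<Longrightarrow> q K' \<in> \<rat>"
    "\<And>K'. K' \<in> ?Q \<Longrightarrow> (\<lambda>n. real (card (exact n S K')) / 2 ^ expo K n) \<longlonglongrightarrow> q K'" by blast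
  have "(\<lambda>n. 1 - (\<Sum>K'\<in>?Q. real (card (exact n S K')) / 2 ^ expo K n)) \<longlonglongrightarrow> 1 - (\<Sum>K'\<in>?Q. q K')"
    by (intro tendsto_diff tendsto_sum tendsto_const q)
  moreover have "\<forall>\<^sub>F n in sequentially. 1 - (\<Sum>K'\<in>?Q. real (card (exact n S K')) / 2 ^ expo K n)
      = real (card (exact n S K)) / 2 ^ expo K n"
    using eventually_subset[OF assms(2)]
  proof eventually_elim
    case (elim n)
    have "real (card (exact n S K)) + (\<Sum>K'\<in>?Q. real (card (exact n S K'))) = 2 ^ expo K n"
      using arg_cong[OF card_exact[OF less.prems elim], of real] by simp
    then have "real (card (exact n S K)) = 2 ^ expo K n - (\<Sum>K'\<in>?Q. real (card (exact n S K')))" by linarith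
    then show ?case unfolding sum_divide_distrib[symmetric] by (simp add: diff_divide_distrib)
  qed
  ultimately have "(\<lambda>n. real (card (exact n S K)) / 2 ^ expo K n) \<longlonglongrightarrow> 1 - (\<Sum>K'\<in>?Q. q K')"
    by (rule Lim_transform_eventually)
  moreover have "1 - (\<Sum>K'\<in>?Q. q K') \<in> \<rat>" using q(1) by (intro Rats_diff Rats_sum) auto
  ultimately show ?case by blast
qed

text \<open>
  Keep a witness \<open>R\<^sub>0\<close> on the cells over \<open>{1..m}\<close> and choose the remaining cells in an arbitrary
  \<open>K\<close>-invariant way: the stabilizer stays \<open>K\<close>.
\<close>
lemma exact_lower_bound:
  assumes "S \<subseteq> {1..m}" "R\<^sub>0 \<subseteq> cells m" "m \<le> n" and K: "K = stab m S R\<^sub>0"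
  shows "2 ^ expo K n \<le> 2 ^ card (cells m) * card (exact n S K)"
proof -
  let ?I = "{R. R \<subseteq> cells n \<and> K \<subseteq> stab n S R}"
  let ?h = "\<lambda>R. (R \<inter> cells m, (R - cells m) \<union> R\<^sub>0)"
  have Sn: "S \<subseteq> {1..n}" using assms by auto
  have pg: "perm_group S K" unfolding K using assms(1) by (rule perm_group_stab)
  have "inj_on ?h ?I"
  proof (rule inj_onI)
    fix R R' assume "?h R = ?h R'"
    then have "R \<inter> cells m = R' \<inter> cells m" "((R - cells m) \<union> R\<^sub>0) - cells m = ((R' - cells m) \<union> R\<^sub>0) - cells m"
      by auto
    then show "R = R'" using assms(2) by blast
  qed
  moreover have "?h ` ?I \<subseteq> Pow (cells m) \<times> exact n S K"
  proof (clarsimp simp: exact_def, intro conjI)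
    fix R assume R: "R \<subseteq> cells n" "K \<subseteq> stab n S R"
    show "R - cells m \<subseteq> cells n" "R\<^sub>0 \<subseteq> cells n" using R assms(2) cells_mono[OF assms(3)] by auto
    show "stab n S ((R - cells m) \<union> R\<^sub>0) = K"
    proof (intro equalityI subsetI)
      fix f assume f: "f \<in> stab n S ((R - cells m) \<union> R\<^sub>0)"
      then have fS: "f permutes S" by (simp add: stab_def)
      have "act f x \<in> R\<^sub>0 \<longleftrightarrow> x \<in> R\<^sub>0" if x: "x \<in> cells m" for x
        using f x cells_mono[OF assms(3)] act_in_cells_iff[OF fS assms(1), of x] by (auto simp: stab_def)
      then show "f \<in> K" using fS by (simp add: K stab_def)
    next
      fix f assume f: "f \<in> K"
      then have fS: "f permutes S" by (simp add: K stab_def)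
      have "act f x \<in> R \<longleftrightarrow> x \<in> R" if "x \<in> cells n" for x
        using that f R(2) by (auto simp: stab_def)
      moreover have "act f x \<in> R\<^sub>0 \<longleftrightarrow> x \<in> R\<^sub>0" for x
        using f assms(2) act_in_cells_iff[OF fS assms(1), of x] by (auto simp: K stab_def)
      ultimately show "f \<in> stab n S ((R - cells m) \<union> R\<^sub>0)"
        using fS act_in_cells_iff[OF fS assms(1)] by (simp add: stab_def)
    qed
  qed
  ultimately have "card ?I \<le> card (Pow (cells m) \<times> exact n S K)"
    by (intro card_inj_on_le[of ?h]) (auto simp: finite_exact finite_cells)
  then show ?thesis
    using card_invariant[OF pg Sn] by (simp add: card_cartesian_product card_Pow finite_cells)
qed

text \<open>A single witness over \<open>{1..m}\<close> keeps the share above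
  \<open>1 / 2 ^ card (cells m)\<close>, a bound independent of \<open>n\<close>.\<close>

lemma exact_limit_pos:
  assumes "S \<subseteq> {1..m}" "R\<^sub>0 \<subseteq> cells m" and K: "K = stab m S R\<^sub>0"
  shows "\<exists>q\<in>\<rat>. q > 0 \<and> (\<lambda>n. real (card (exact n S K)) / 2 ^ expo K n) \<longlonglongrightarrow> q"
proof -
  have pg: "perm_group S K" unfolding K using assms(1) by (rule perm_group_stab)
  obtain q where q: "q \<in> \<rat>" "(\<lambda>n. real (card (exact n S K)) / 2 ^ expo K n) \<longlonglongrightarrow> q"
    using exact_limit[OF pg assms(1)] by blast
  have "1 / 2 ^ card (cells m) \<le> q"
  proof (rule tendsto_lowerbound[OF q(2)])
    show "\<forall>\<^sub>F n in sequentially. 1 / 2 ^ card (cells m) \<le> real (card (exact n S K)) / 2 ^ expo K n"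
      using eventually_ge_at_top[of m]
    proof eventually_elim
      case (elim n)
      have "real (2 ^ expo K n) \<le> real (2 ^ card (cells m) * card (exact n S K))"
        using exact_lower_bound[OF assms(1,2) elim K] by (rule of_nat_mono)
      then show ?case by (simp add: field_simps)
    qed
  qed simp
  then have "q > 0" by (meson less_le_trans zero_less_divide_1_iff zero_less_numeral zero_less_power)
  then show ?thesis using q by blast
qed

end

section \<open>Structures with automorphism groups of large defect\<close>

text \<open>Lowering the base by \<open>m\<close> costs at most the linear term of the expansion.
  Its counterpart \<open>power_diff_upper\<close> says that for small \<open>m\<close> it costs
  nearly the whole linear term.\<close>

lemma power_diff_lower: "m \<le> n \<Longrightarrow> (n::nat) ^ r \<le> (n - m) ^ r + r * m * n ^ (r - 1)"
proof (induction r)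
  case (Suc k)
  have "n ^ Suc k \<le> n * ((n - m) ^ k + k * m * n ^ (k - 1))"
    using Suc by simp
  also have "\<dots> = (n - m) * (n - m) ^ k + m * (n - m) ^ k + k * m * (n * n ^ (k - 1))"
    using Suc.prems by (simp add: algebra_simps diff_mult_distrib)
  also have "k * m * (n * n ^ (k - 1)) = k * m * n ^ k" by (cases k) auto
  also have "(n - m) * (n - m) ^ k + m * (n - m) ^ k + k * m * n ^ k
      \<le> (n - m) ^ Suc k + m * n ^ k + k * m * n ^ k"
    by (intro add_mono mult_left_mono power_mono) auto
  finally show ?case by (simp add: algebra_simps)
qed simp

lemma power_add_lower: "(a::nat) ^ r + r * m * a ^ (r - 1) \<le> (a + m) ^ r"
proof (induction r)
  case (Suc k)
  have "a ^ Suc k + Suc k * m * a ^ k = a * a ^ k + m * a ^ k + k * m * a ^ k"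
    by (simp add: algebra_simps)
  also have "k * m * a ^ k = a * (k * m * a ^ (k - 1))" by (auto simp: power_eq_if)
  also have "a * a ^ k + m * a ^ k + a * (k * m * a ^ (k - 1)) \<le> (a + m) * (a ^ k + k * m * a ^ (k - 1))"
    by (simp add: algebra_simps)
  also have "\<dots> \<le> (a + m) ^ Suc k" using Suc by simp
  finally show ?case by simp
qed simp

text \<open>The linear term at base \<open>n - m\<close> is a lower bound for the cost, and by
  Bernoulli's inequality \<open>(n - m) ^ (r - 1)\<close> is at least \<open>1 - \<epsilon>\<close>
  times \<open>n ^ (r - 1)\<close>.\<close>

lemma power_diff_upper:
  fixes \<epsilon> :: real
  assumes "m \<le> n" "n > 0" "real r * real m \<le> \<epsilon> * real n"
  shows "real ((n - m) ^ r) \<le> real (n ^ r) - (1 - \<epsilon>) * (real m * (real r * real (n ^ (r - 1))))"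
proof -
  have "1 - \<epsilon> \<le> (1 - real m / real n) ^ (r - 1)"
  proof -
    have "real (r - 1) * (real m / real n) \<le> \<epsilon>"
    proof -
      have "real (r - 1) * real m \<le> real r * real m" by (intro mult_right_mono) auto
      then show ?thesis using assms by (simp add: field_simps)
    qed
    moreover have "1 + real (r - 1) * - (real m / real n) \<le> (1 + - (real m / real n)) ^ (r - 1)"
      using assms by (intro Bernoulli_inequality) (simp add: field_simps)
    ultimately show ?thesis by simp
  qed
  then have "(1 - \<epsilon>) * real n ^ (r - 1) \<le> (1 - real m / real n) ^ (r - 1) * real n ^ (r - 1)"
    by (rule mult_right_mono) simp
  also have "\<dots> = real (n - m) ^ (r - 1)"
    using assms by (simp add: of_nat_diff field_simps flip: power_mult_distrib)
  finally have "real r * real m * ((1 - \<epsilon>) * real n ^ (r - 1)) \<le> real r * real m * real (n - m) ^ (r - 1)"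
    by (rule mult_left_mono) simp
  moreover have "real ((n - m) ^ r + r * m * (n - m) ^ (r - 1)) \<le> real (n ^ r)"
    using power_add_lower[of "n - m" r m] assms(1) by (intro of_nat_mono) simp
  ultimately show ?thesis by (simp add: algebra_simps)
qed

text \<open>Equal orbits give equal defects. It is applied in contraposition: two different defects
  produce an element of the larger group that leaves an orbit of the smaller one.\<close>

lemma defect_eqI:
  assumes "perm_group S K" "perm_group S K'" "finite S" "K \<subseteq> K'"
    and "\<And>g x. g \<in> K' \<Longrightarrow> x \<in> S \<Longrightarrow> \<exists>f\<in>K. g x = f x"
  shows "defect K = defect K'"
proof -
  have "orbit_rel K (\<lambda>f. f) S = orbit_rel K' (\<lambda>f. f) S"
    using assms(4,5) by (auto simp: orbit_rel_def)
  then show ?thesis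
    using num_orbits_defect[OF assms(1) subset_refl assms(3)] num_orbits_defect[OF assms(2) subset_refl assms(3)]
    by (simp add: num_orbits_def)
qed

text \<open>A permutation is determined by its graph over the moved points, which is a set of
  \<open>m\<close> among the \<open>n ^ 2\<close> pairs.\<close>

lemma card_permutations_moving:
  "card {g. g permutes {1..n} \<and> card (moved g) = m} \<le> (n ^ 2) ^ m"
proof -
  let ?G = "{g. g permutes {1..n} \<and> card (moved g) = m}"
  let ?gr = "\<lambda>g. (\<lambda>x. (x, g x)) ` moved g"
  have "inj_on ?gr ?G"
  proof (rule inj_onI, rule ext)
    fix g h x assume eq: "?gr g = ?gr h"
    have "(x, y) \<in> ?gr g \<longleftrightarrow> g x \<noteq> x \<and> y = g x" "(x, y) \<in> ?gr h \<longleftrightarrow> h x \<noteq> x \<and> y = h x" for y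
      by (auto simp: moved_def)
    then show "g x = h x" using eq by metis
  qed
  moreover have "?gr ` ?G \<subseteq> {A. A \<subseteq> {1..n} \<times> {1..n} \<and> card A = m}"
  proof clarify
    fix g assume g: "g permutes {1..n}" "m = card (moved g)"
    have "?gr g \<subseteq> {1..n} \<times> {1..n}"
      using moved_subset[OF g(1)] permutes_in_image[OF g(1)] by blast
    moreover have "card (?gr g) = card (moved g)" by (intro card_image inj_onI) auto
    ultimately show "?gr g \<subseteq> {1..n} \<times> {1..n} \<and> card (?gr g) = card (moved g)" by simp
  qed
  ultimately have "card ?G \<le> card {A. A \<subseteq> {1..n} \<times> {1..n} \<and> card A = m}"
    by (intro card_inj_on_le[of ?gr]) auto
  also have "\<dots> = (n ^ 2) choose m" by (simp add: n_subsets power2_eq_square)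
  also have "\<dots> \<le> (n ^ 2) ^ m" 
    by (cases "m \<le> n ^ 2") (auto simp: binomial_le_pow binomial_eq_0)
  finally show ?thesis .
qed

lemma card_small_subsets:
  assumes "n > 0" shows "card {S. S \<subseteq> {1..n} \<and> card S \<le> s} \<le> (s + 1) * n ^ s"
proof -
  have "{S. S \<subseteq> {1..n} \<and> card S \<le> s} = (\<Union>k\<in>{..s}. {S. S \<subseteq> {1..n} \<and> card S = k})" by auto
  then have "card {S. S \<subseteq> {1..n} \<and> card S \<le> s} \<le> (\<Sum>k\<in>{..s}. card {S. S \<subseteq> {1..n} \<and> card S = k})"
    using card_UN_le[of "{..s}" "\<lambda>k. {S. S \<subseteq> {1..n} \<and> card S = k}"] by simp
  also have "\<dots> = (\<Sum>k\<in>{..s}. n choose k)" by (simp add: n_subsets)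
  also have "\<dots> \<le> (\<Sum>k\<in>{..s}. n ^ s)"
  proof (rule sum_mono)
    fix k assume "k \<in> {..s}"
    then have "n ^ k \<le> n ^ s" using assms by (intro power_increasing) auto
    then show "n choose k \<le> n ^ s"
      by (cases "k \<le> n") (auto simp: binomial_eq_0 intro: order_trans[OF binomial_le_pow])
  qed
  finally show ?thesis by simp
qed

lemma card_perm_groups_le:
  assumes "finite S" "card S \<le> s"
  shows "card {K. perm_group S K} \<le> 2 ^ fact s"
proof -
  have "card {K. perm_group S K} \<le> card (Pow {f. f permutes S})"
    by (intro card_mono) (auto simp: perm_group_def finite_permutations assms)
  also have "\<dots> = 2 ^ fact (card S)"
    using assms by (simp add: card_Pow finite_permutations card_permutations)
  also have "\<dots> \<le> 2 ^ fact s" using assms by (intro power_increasing fact_mono) auto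
  finally show ?thesis .
qed

section \<open>First-order size of the exponent\<close>

locale relational_vocabulary = vocabulary +
  assumes \<rho>_pos: "\<rho> \<ge> 1" and max_arity: "Max (ar ` {1..\<rho>}) \<ge> 2"
begin

definition rmax :: nat
  where "rmax = Max (ar ` {1..\<rho>})"

text \<open>The derivative of the number of cells with respect to \<open>n\<close>: to first order,
  the number of cell orbits lost per unit of defect.\<close>

definition loss :: "nat \<Rightarrow> nat"
  where "loss n = (\<Sum>i\<in>{1..\<rho>}. ar i * n ^ (ar i - 1))"

lemma rmax_ge: "rmax \<ge> 2" "i \<in> {1..\<rho>} \<Longrightarrow> ar i \<le> rmax"
  using max_arity by (auto simp: rmax_def)

text \<open>This is where an arity of at least two enters: a loss growing linearly in
  \<open>n\<close> makes \<open>2\<close> to its negative beat every power of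
  \<open>n\<close>.\<close>

lemma loss_ge: "loss n \<ge> 2 * n"
proof (cases "n = 0")
  case False
  have "rmax \<in> ar ` {1..\<rho>}" unfolding rmax_def using \<rho>_pos by (intro Max_in) auto
  then obtain i where i: "i \<in> {1..\<rho>}" "ar i = rmax" by auto
  have "n ^ 1 \<le> n ^ (ar i - 1)" using False rmax_ge(1) i(2) by (intro power_increasing) auto
  then have "2 * n \<le> ar i * n ^ (ar i - 1)" using rmax_ge(1) i(2) by (intro mult_le_mono) auto
  also have "\<dots> \<le> loss n" unfolding loss_def using i(1) by (intro member_le_sum) auto
  finally show ?thesis .
qed simp

lemma card_moved_le: "f permutes S \<Longrightarrow> S \<subseteq> {1..n} \<Longrightarrow> card (moved f) \<le> n"
  using card_mono[of "{1..n}" "moved f"] moved_subset[of f S] by auto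

text \<open>Burnside's lemma averages \<open>power_diff_lower\<close> over \<open>K\<close>, and the
  average number of moved points is the defect.\<close>

lemma expo_lower:
  assumes "perm_group S K" "S \<subseteq> {1..n}"
  shows "real (expo K n) \<ge> real (card (cells n)) - real (defect K) * real (loss n)"
proof -
  have finS: "finite S" using assms(2) finite_subset by blast
  have pos: "card K > 0" using perm_group_card_pos[OF assms(1) finS] .
  have "card K * card (cells n) = (\<Sum>f\<in>K. \<Sum>i\<in>{1..\<rho>}. n ^ ar i)" by (simp add: card_cells)
  also have "\<dots> \<le> (\<Sum>f\<in>K. \<Sum>i\<in>{1..\<rho>}. (n - card (moved f)) ^ ar i + card (moved f) * (ar i * n ^ (ar i - 1)))"
  proof (intro sum_mono)
    fix f i assume "f \<in> K"
    then have "card (moved f) \<le> n" using card_moved_le[OF perm_groupD(1)[OF assms(1)] assms(2)] by blast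
    then show "n ^ ar i \<le> (n - card (moved f)) ^ ar i + card (moved f) * (ar i * n ^ (ar i - 1))"
      using power_diff_lower[of "card (moved f)" n "ar i"] by (simp add: mult.commute mult.left_commute)
  qed
  also have "\<dots> = expo K n * card K + (\<Sum>f\<in>K. card (moved f)) * loss n"
    by (simp add: sum.distrib expo_burnside[OF assms] loss_def flip: sum_distrib_left sum_distrib_right)
  also have "(\<Sum>f\<in>K. card (moved f)) = defect K * card K"
    using defect_card[OF assms] by simp
  finally have "card K * card (cells n) \<le> card K * (expo K n + defect K * loss n)"
    by (simp add: algebra_simps)
  then have "card (cells n) \<le> expo K n + defect K * loss n" using pos by simp
  then have "real (card (cells n)) \<le> real (expo K n + defect K * loss n)" by (rule of_nat_mono)
  then show ?thesis by simp
qed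

text \<open>The same average with \<open>power_diff_upper\<close>. The support must be small against
  \<open>n\<close>, so that each element of \<open>K\<close> moves few enough points for a relative
  error \<open>\<epsilon>\<close>.\<close>

lemma expo_upper:
  assumes "perm_group S K" "S \<subseteq> {1..n}" "n > 0" "real rmax * real (card S) \<le> \<epsilon> * real n"
  shows "real (expo K n) \<le> real (card (cells n)) - (1 - \<epsilon>) * (real (defect K) * real (loss n))"
proof -
  have finS: "finite S" using assms(2) finite_subset by blast
  have pos: "card K > 0" using perm_group_card_pos[OF assms(1) finS] .
  have "real (expo K n * card K) = (\<Sum>f\<in>K. \<Sum>i\<in>{1..\<rho>}. real ((n - card (moved f)) ^ ar i))"
    unfolding expo_burnside[OF assms(1,2)] by (simp only: of_nat_sum)
  also have "\<dots> \<le> (\<Sum>f\<in>K. \<Sum>i\<in>{1..\<rho>}. real (n ^ ar i) -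
      (1 - \<epsilon>) * (real (card (moved f)) * (real (ar i) * real (n ^ (ar i - 1)))))"
  proof (intro sum_mono power_diff_upper assms(3))
    fix f i assume f: "f \<in> K" and i: "i \<in> {1..\<rho>}"
    note p = perm_groupD(1)[OF assms(1) f]
    show "card (moved f) \<le> n" using card_moved_le[OF p assms(2)] .
    have "real (ar i) * real (card (moved f)) \<le> real rmax * real (card S)"
      using rmax_ge(2)[OF i] card_mono[OF finS moved_subset[OF p]] by (intro mult_mono) auto
    then show "real (ar i) * real (card (moved f)) \<le> \<epsilon> * real n" using assms(4) by linarith
  qed
  also have "\<dots> = real (card K) * real (card (cells n)) -
      (1 - \<epsilon>) * (real (\<Sum>f\<in>K. card (moved f)) * real (loss n))"
    by (simp add: sum_subtractf card_cells loss_def flip: sum_distrib_left sum_distrib_right)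
  also have "(\<Sum>f\<in>K. card (moved f)) = defect K * card K"
    using defect_card[OF assms(1,2)] by simp
  finally have "real (card K) * real (expo K n) \<le>
      real (card K) * (real (card (cells n)) - (1 - \<epsilon>) * (real (defect K) * real (loss n)))"
    by (simp add: algebra_simps)
  then show ?thesis using pos by simp
qed

lemma card_invariant_permutation:
  assumes g: "g permutes {1..n}"
  shows "real (card {R. R \<subseteq> cells n \<and> g \<in> stab n {1..n} R})
    \<le> 2 powr (real (card (cells n)) - real (card (moved g)) * real (loss n) / (2 * real rmax))"
proof -
  let ?m = "card (moved g)"
  \<comment> \<open>In place of the cyclic group generated by \<open>g\<close>: the closure of
    \<open>g\<close>, consisting of all permutations that preserve every structure preserved by
    \<open>g\<close>. It is a group with the same invariant structures by construction.\<close>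
  define C where "C = {h. h permutes {1..n} \<and> (\<forall>R\<subseteq>cells n. g \<in> stab n {1..n} R \<longrightarrow> h \<in> stab n {1..n} R)}"
  have pg: "perm_group {1..n} C"
    using perm_groupD(2-4)[OF perm_group_stab[of "{1..n}" n]]
    by (auto simp: perm_group_def C_def permutes_id permutes_compose permutes_inv)
  have "card {R. R \<subseteq> cells n \<and> g \<in> stab n {1..n} R} \<le> card {R. R \<subseteq> cells n \<and> C \<subseteq> stab n {1..n} R}"
  proof (rule card_mono)
    show "finite {R. R \<subseteq> cells n \<and> C \<subseteq> stab n {1..n} R}"
      by (rule finite_subset[of _ "Pow (cells n)"]) (auto simp: finite_cells)
  qed (auto simp: C_def)
  also have "\<dots> = 2 ^ expo C n" using card_invariant[OF pg] by simp
  finally have "real (card {R. R \<subseteq> cells n \<and> g \<in> stab n {1..n} R}) \<le> real (2 ^ expo C n)"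
    by (rule of_nat_mono)
  also have "\<dots> = 2 powr real (expo C n)" by (simp add: powr_realpow)
  also have "\<dots> \<le> 2 powr (real (card (cells n)) - real ?m * real (loss n) / (2 * real rmax))"
  proof -
    have gC: "g \<in> C" using g by (simp add: C_def)
    have "card {x \<in> cells n. \<forall>f\<in>C. act f x = x} \<le> card {x \<in> cells n. act g x = x}"
      using gC finite_cells by (intro card_mono) auto
    then have "2 * expo C n \<le> card (cells n) + (\<Sum>i\<in>{1..\<rho>}. (n - ?m) ^ ar i)"
      using perm_action.twice_num_orbits_le[OF perm_action_act[OF pg subset_refl]]
        card_fixed_cells[OF g subset_refl] by (simp add: expo_def)
    then have "rmax * (2 * expo C n) \<le> rmax * (card (cells n) + (\<Sum>i\<in>{1..\<rho>}. (n - ?m) ^ ar i))"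
      by (rule mult_le_mono2)
    \<comment> \<open>For arity \<open>k + 1\<close> at least \<open>?m * n ^ k\<close> cells are
      not fixed by \<open>g\<close>; comparing this with the summand \<open>ar i * n ^ k\<close> of
      \<open>loss n\<close> costs a factor of at most \<open>rmax\<close>.\<close>
    moreover have "rmax * (\<Sum>i\<in>{1..\<rho>}. (n - ?m) ^ ar i) + ?m * loss n \<le> rmax * card (cells n)"
      unfolding card_cells loss_def sum_distrib_left sum.distrib[symmetric]
    proof (rule sum_mono)
      fix i assume i: "i \<in> {1..\<rho>}"
      show "rmax * (n - ?m) ^ ar i + ?m * (ar i * n ^ (ar i - 1)) \<le> rmax * n ^ ar i"
      proof (cases "ar i")
        case (Suc k)
        have "?m \<le> n" by (rule card_moved_le[OF g subset_refl])
        have "(n - ?m) ^ ar i + ?m * n ^ k \<le> (n - ?m) * n ^ k + ?m * n ^ k"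
          unfolding Suc power_Suc by (intro add_right_mono mult_left_mono power_mono) auto
        also have "\<dots> = n ^ ar i" using \<open>?m \<le> n\<close> Suc by (simp flip: add_mult_distrib)
        finally have "rmax * ((n - ?m) ^ ar i + ?m * n ^ k) \<le> rmax * n ^ ar i" by (rule mult_le_mono2)
        moreover have "?m * (ar i * n ^ k) \<le> ?m * (rmax * n ^ k)"
          using rmax_ge(2)[OF i] by (intro mult_le_mono) auto
        ultimately show ?thesis using Suc by (simp add: algebra_simps)
      qed simp
    qed
    ultimately have "2 * rmax * expo C n + ?m * loss n \<le> 2 * rmax * card (cells n)"
      by (simp add: algebra_simps)
    then have "real (2 * rmax * expo C n + ?m * loss n) \<le> real (2 * rmax * card (cells n))"
      by (rule of_nat_mono)
    then show ?thesis using rmax_ge(1) by (simp add: field_simps)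
  qed
  finally show ?thesis .
qed

text \<open>Grow \<open>S\<close> from the empty set. As long as the defect over \<open>S\<close> is
  too small, the orbits differ from those of the full group, and adding the at most \<open>s\<close>
  points moved by an automorphism that joins two orbits raises the defect. So a large defect is
  already visible on a set of bounded size.\<close>

lemma stab_chain:
  assumes "\<And>g. g \<in> stab n {1..n} R \<Longrightarrow> card (moved g) \<le> s"
    and "k \<le> defect (stab n {1..n} R)"
  shows "\<exists>S\<subseteq>{1..n}. card S \<le> k * s \<and> k \<le> defect (stab n S R)"
  using assms(2)
proof (induction k)
  case 0
  then show ?case by (intro exI[of _ "{}"]) auto
next
  case (Suc k)
  let ?A = "stab n {1..n} R"
  obtain S where S: "S \<subseteq> {1..n}" "card S \<le> k * s" "k \<le> defect (stab n S R)"
    using Suc by auto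
  show ?case
  proof (cases "Suc k \<le> defect (stab n S R)")
    case True
    then show ?thesis using S by (intro exI[of _ S]) auto
  next
    case False
    have pg: "perm_group {1..n} ?A" by (simp add: perm_group_stab)
    have pgS: "perm_group {1..n} (stab n S R)"
      by (rule perm_group_mono[OF perm_group_stab[OF S(1)] S(1)])
    obtain g x where g: "g \<in> ?A" "x \<in> {1..n}" "\<And>f. f \<in> stab n S R \<Longrightarrow> g x \<noteq> f x"
      using defect_eqI[OF pgS pg _ stab_subset[OF S(1)]] False Suc.prems by force
    define T where "T = S \<union> moved g"
    have gp: "g permutes {1..n}" using g(1) by (simp add: stab_def)
    have T: "T \<subseteq> {1..n}" using S(1) moved_subset[OF gp] by (simp add: T_def)
    have "card T \<le> Suc k * s"
      using S(2) assms(1)[OF g(1)] card_Un_le[of S "moved g"] by (simp add: T_def)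
    moreover have "g \<in> stab n T R"
      using g(1) permutes_iff_moved[OF gp, of T] by (auto simp: stab_def T_def)
    then have "defect (stab n S R) < defect (stab n T R)"
      using defect_strict_mono[OF pgS perm_group_mono[OF perm_group_stab[OF T] T] _ stab_subset[of S T], of g x] g
      by (auto simp: T_def)
    ultimately show ?thesis using T S(3) by (intro exI[of _ T]) auto
  qed
qed

section \<open>Negligibility of structures of large defect\<close>

definition bad :: "nat \<Rightarrow> nat \<Rightarrow> (nat \<times> nat list) set set"
  where "bad D n = {R. R \<subseteq> cells n \<and> defect (stab n {1..n} R) > D}"

lemma finite_bad: "finite (bad D n)"
  by (rule finite_subset[of _ "Pow (cells n)"]) (auto simp: bad_def finite_cells)

text \<open>A union bound over two cases: some automorphism moves more than \<open>s\<^sub>1\<close>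
  points, or none does and \<open>stab_chain\<close> with \<open>D + 1\<close> steps finds a set of
  at most \<open>s\<^sub>0\<close> points whose stabilizer has defect above \<open>D\<close>. In the
  second case \<open>expo_upper\<close> applies, since \<open>n\<close> is large compared with
  \<open>s\<^sub>0\<close>.\<close>

lemma card_bad_bound:
  fixes D n s\<^sub>1 s\<^sub>0 :: nat
  defines "s\<^sub>1 \<equiv> 4 * rmax * D" and "s\<^sub>0 \<equiv> (D + 1) * s\<^sub>1"
  assumes n: "n > 0" "n \<ge> 2 * (D + 1) * (rmax * s\<^sub>0)"
  shows "real (card (bad D n)) \<le>
    (\<Sum>m\<in>{s\<^sub>1<..n}. (real n ^ 2) ^ m * 2 powr (real (card (cells n)) - real m * real (loss n) / (2 * real rmax)))
    + real ((s\<^sub>0 + 1) * n ^ s\<^sub>0 * 2 ^ fact s\<^sub>0) * 2 powr (real (card (cells n)) - (real D + 1/2) * real (loss n))"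
proof -
  let ?G = "\<lambda>m. {g. g permutes {1..n} \<and> card (moved g) = m}"
  let ?I = "\<lambda>g. {R. R \<subseteq> cells n \<and> g \<in> stab n {1..n} R}"
  let ?S = "{S. S \<subseteq> {1..n} \<and> card S \<le> s\<^sub>0}"
  let ?Q = "\<lambda>S. {K. perm_group S K \<and> defect K > D}"
  let ?J = "\<lambda>S K. {R. R \<subseteq> cells n \<and> K \<subseteq> stab n S R}"
  let ?B1 = "\<Union>m\<in>{s\<^sub>1<..n}. \<Union>g\<in>?G m. ?I g" and ?B2 = "\<Union>S\<in>?S. \<Union>K\<in>?Q S. ?J S K"
  have finG: "finite (?G m)" for m
    by (rule finite_subset[OF _ finite_permutations[of "{1..n}"]]) auto
  have finQ: "finite (?Q S)" if "S \<in> ?S" for S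
    using that finite_perm_groups[of S] finite_subset[of S "{1..n}"] by (auto elim: rev_finite_subset)
  have "bad D n \<subseteq> ?B1 \<union> ?B2"
  proof
    fix R assume R: "R \<in> bad D n"
    show "R \<in> ?B1 \<union> ?B2"
    proof (cases "\<exists>g\<in>stab n {1..n} R. card (moved g) > s\<^sub>1")
      case True
      then obtain g where g: "g \<in> stab n {1..n} R" "card (moved g) > s\<^sub>1" by blast
      then have "g permutes {1..n}" by (simp add: stab_def)
      then have "g \<in> ?G (card (moved g))" "card (moved g) \<in> {s\<^sub>1<..n}"
        using card_moved_le[of g "{1..n}" n] g by auto
      moreover have "R \<in> ?I g" using R g by (simp add: bad_def)
      ultimately show ?thesis by blast
    next
      case False
      then obtain S where "S \<subseteq> {1..n}" "card S \<le> (D + 1) * s\<^sub>1" "D + 1 \<le> defect (stab n S R)"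
        using stab_chain[of n R s\<^sub>1 "D + 1"] R by (force simp: bad_def)
      then have "S \<in> ?S" "stab n S R \<in> ?Q S" "R \<in> ?J S (stab n S R)"
        using R perm_group_stab by (auto simp: s\<^sub>0_def bad_def)
      then show ?thesis by blast
    qed
  qed
  moreover have sub: "?B1 \<union> ?B2 \<subseteq> Pow (cells n)" by blast
  ultimately have "card (bad D n) \<le> card (?B1 \<union> ?B2)"
    by (intro card_mono finite_subset[OF sub]) (simp_all add: finite_cells)
  also have "\<dots> \<le> card ?B1 + card ?B2" by (rule card_Un_le)
  finally have "real (card (bad D n)) \<le> real (card ?B1) + real (card ?B2)" by linarith
  moreover have "real (card ?B1) \<le>
    (\<Sum>m\<in>{s\<^sub>1<..n}. (real n ^ 2) ^ m * 2 powr (real (card (cells n)) - real m * real (loss n) / (2 * real rmax)))"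
  proof -
    have c: "card ?B1 \<le> (\<Sum>m\<in>{s\<^sub>1<..n}. \<Sum>g\<in>?G m. card (?I g))"
      by (rule order_trans[OF card_UN_le sum_mono[OF card_UN_le]]) (intro finite_greaterThanAtMost finG)+
    have "real (card ?B1) \<le> (\<Sum>m\<in>{s\<^sub>1<..n}. \<Sum>g\<in>?G m. real (card (?I g)))"
      using of_nat_mono[OF c, where 'a = real] by (simp only: of_nat_sum)
    also have "\<dots> \<le> (\<Sum>m\<in>{s\<^sub>1<..n}. \<Sum>g\<in>?G m. 2 powr (real (card (cells n)) - real m * real (loss n) / (2 * real rmax)))"
      by (intro sum_mono) (use card_invariant_permutation in auto)
    also have "\<dots> \<le> (\<Sum>m\<in>{s\<^sub>1<..n}. (real n ^ 2) ^ m * 2 powr (real (card (cells n)) - real m * real (loss n) / (2 * real rmax)))"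
    proof (rule sum_mono)
      fix m
      have "real (card (?G m)) \<le> (real n ^ 2) ^ m"
        using of_nat_mono[OF card_permutations_moving[of n m], where 'a = real] by simp
      then show "(\<Sum>g\<in>?G m. 2 powr (real (card (cells n)) - real m * real (loss n) / (2 * real rmax)))
        \<le> (real n ^ 2) ^ m * 2 powr (real (card (cells n)) - real m * real (loss n) / (2 * real rmax))"
        unfolding sum_constant by (intro mult_right_mono) auto
    qed
    finally show ?thesis .
  qed
  moreover have "real (card ?B2) \<le>
    real ((s\<^sub>0 + 1) * n ^ s\<^sub>0 * 2 ^ fact s\<^sub>0) * 2 powr (real (card (cells n)) - (real D + 1/2) * real (loss n))"
  proof -
    let ?b = "2 powr (real (card (cells n)) - (real D + 1/2) * real (loss n))"
    have J: "real (card (?J S K)) \<le> ?b" if "S \<in> ?S" "K \<in> ?Q S" for S K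
    proof -
      have S: "S \<subseteq> {1..n}" "card S \<le> s\<^sub>0" and K: "perm_group S K" "defect K \<ge> D + 1" using that by auto
      \<comment> \<open>Chosen so that \<open>(1 - \<epsilon>) * (D + 1) = D + 1/2\<close>: half a
        unit of defect is kept as a gain over the groups of defect \<open>D\<close>.\<close>
      define \<epsilon> where "\<epsilon> = 1 / (2 * (real D + 1))"
      have "2 * (D + 1) * (rmax * card S) \<le> n"
        using n(2) S(2) by (meson mult_le_mono2 order_trans)
      then have "real (2 * (D + 1) * (rmax * card S)) \<le> real n" by (rule of_nat_mono)
      then have "real rmax * real (card S) \<le> \<epsilon> * real n" by (simp add: \<epsilon>_def field_simps)
      note u = expo_upper[OF K(1) S(1) n(1) this]
      have "\<epsilon> \<le> 1" by (simp add: \<epsilon>_def field_simps)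
      then have "(1 - \<epsilon>) * ((real D + 1) * real (loss n)) \<le> (1 - \<epsilon>) * (real (defect K) * real (loss n))"
        using K(2) by (intro mult_left_mono mult_right_mono) auto
      moreover have "(1 - \<epsilon>) * ((real D + 1) * real (loss n)) = (real D + 1/2) * real (loss n)"
        by (simp add: \<epsilon>_def field_simps)
      ultimately have "real (expo K n) \<le> real (card (cells n)) - (real D + 1/2) * real (loss n)"
        using u by linarith
      then show ?thesis by (simp add: card_invariant[OF K(1) S(1)] powr_realpow[symmetric])
    qed
    have c: "card ?B2 \<le> (\<Sum>S\<in>?S. \<Sum>K\<in>?Q S. card (?J S K))"
      by (rule order_trans[OF card_UN_le sum_mono[OF card_UN_le]]) (use finQ in simp_all)
    have "real (card ?B2) \<le> (\<Sum>S\<in>?S. \<Sum>K\<in>?Q S. real (card (?J S K)))"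
      using of_nat_mono[OF c, where 'a = real] by (simp only: of_nat_sum)
    also have "\<dots> \<le> (\<Sum>S\<in>?S. \<Sum>K\<in>?Q S. ?b)" by (intro sum_mono J)
    also have "\<dots> \<le> (\<Sum>S\<in>?S. 2 ^ fact s\<^sub>0 * ?b)"
    proof (rule sum_mono)
      fix S assume S: "S \<in> ?S"
      then have finS: "finite S" by (auto intro: finite_subset)
      have "card (?Q S) \<le> card {K. perm_group S K}"
        using finite_perm_groups[OF finS] by (intro card_mono) auto
      also have "\<dots> \<le> 2 ^ fact s\<^sub>0" using card_perm_groups_le[OF finS] S by auto
      finally have "real (card (?Q S)) \<le> 2 ^ fact s\<^sub>0" using of_nat_mono by fastforce
      then show "(\<Sum>K\<in>?Q S. ?b) \<le> 2 ^ fact s\<^sub>0 * ?b"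
        unfolding sum_constant by (intro mult_right_mono) auto
    qed
    also have "\<dots> = real (card ?S) * (2 ^ fact s\<^sub>0 * ?b)" by simp
    also have "\<dots> \<le> real ((s\<^sub>0 + 1) * n ^ s\<^sub>0) * (2 ^ fact s\<^sub>0 * ?b)"
      by (intro mult_right_mono of_nat_mono card_small_subsets n) auto
    also have "\<dots> = real ((s\<^sub>0 + 1) * n ^ s\<^sub>0 * 2 ^ fact s\<^sub>0) * ?b" by simp
    finally show ?thesis .
  qed
  ultimately show ?thesis by linarith
qed

text \<open>By \<open>expo_lower\<close>, a group of defect \<open>D\<close> has at least
  \<open>2\<close> to the power \<open>card (cells n) - D * loss n\<close> invariant structures.
  Against this, permutations moving \<open>m\<close> points contribute at most the
  \<open>m\<close>-th power of \<open>n ^ 2 * 2 powr (- L * n)\<close>; this base is eventually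
  below 1, so each of the at most \<open>n\<close> terms is bounded by the base itself. The groups
  on small sets contribute a polynomial times \<open>2 powr (- n)\<close>. The factor
  \<open>n ^ k\<close> will pay for the number of small supports.\<close>

lemma bad_negligible:
  assumes "perm_group S K" "S \<subseteq> {1..N}" "defect K = D"
  shows "(\<lambda>n. real n ^ k * (real (card (bad D n)) / 2 ^ expo K n)) \<longlonglongrightarrow> 0"
proof -
  define s\<^sub>1 where "s\<^sub>1 = 4 * rmax * D"
  define s\<^sub>0 where "s\<^sub>0 = (D + 1) * s\<^sub>1"
  define L where "L = 1 / (2 * real rmax)"
  define C where "C = real (s\<^sub>0 + 1) * 2 ^ fact s\<^sub>0"
  have L: "L > 0" using rmax_ge(1) by (simp add: L_def)
  let ?u = "\<lambda>n. real n ^ k * (real n * (real n ^ 2 * 2 powr (- L * real n)) + C * real n ^ s\<^sub>0 * 2 powr (- real n))"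
  have "(\<lambda>n. real n ^ k * (real n * (real n ^ 2 * 2 powr (- L * real n)))) \<longlonglongrightarrow> 0"
    using L by real_asymp
  moreover have "(\<lambda>n. real n ^ k * (real n ^ s\<^sub>0 * 2 powr (- real n))) \<longlonglongrightarrow> 0"
    by real_asymp
  ultimately have "(\<lambda>n. real n ^ k * (real n * (real n ^ 2 * 2 powr (- L * real n)))
      + C * (real n ^ k * (real n ^ s\<^sub>0 * 2 powr (- real n)))) \<longlonglongrightarrow> 0 + C * 0"
    by (intro tendsto_add tendsto_mult tendsto_const)
  then have u: "?u \<longlonglongrightarrow> 0" by (simp add: algebra_simps)
  have small: "\<forall>\<^sub>F n in sequentially. real n ^ 2 * 2 powr (- L * real n) < 1"
    by (rule order_tendstoD(2)[of _ 0]) (use L in real_asymp, simp)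
  have "\<forall>\<^sub>F n in sequentially. real n ^ k * (real (card (bad D n)) / 2 ^ expo K n) \<le> ?u n"
    using small eventually_subset[OF assms(2)] eventually_gt_at_top[of 0]
      eventually_ge_at_top[of "2 * (D + 1) * (rmax * s\<^sub>0)"]
  proof eventually_elim
    case (elim n)
    let ?X = "real (card (cells n))" and ?W = "real (loss n)"
    have W: "?W \<ge> 2 * real n" using of_nat_mono[OF loss_ge[of n], where 'a = real] by simp
    have e: "2 powr (?X - real D * ?W) \<le> 2 ^ expo K n"
      using expo_lower[OF assms(1) elim(2)] assms(3) by (simp add: powr_realpow[symmetric])
    \<comment> \<open>The origin of \<open>s\<^sub>1 = 4 * rmax * D\<close>: for larger
      \<open>m\<close> the number \<open>D\<close> is at most \<open>m / (4 * rmax)\<close>, so half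
      of the gain \<open>m / (2 * rmax)\<close> survives the comparison with defect
      \<open>D\<close>.\<close>
    have e1: "2 powr (?X - real m * ?W / (2 * real rmax)) / 2 ^ expo K n \<le> (2 powr (- L * real n)) ^ m"
      if "m \<in> {s\<^sub>1<..n}" for m
    proof -
      have "real m \<ge> 4 * real rmax * real D"
        using that of_nat_mono[of "4 * rmax * D" m, where 'a = real] by (simp add: s\<^sub>1_def)
      then have "real m / (2 * real rmax) - real D \<ge> real m / (4 * real rmax)"
        using rmax_ge(1) by (simp add: field_simps)
      then have "(real m / (2 * real rmax) - real D) * ?W \<ge> real m / (4 * real rmax) * (2 * real n)"
        using W by (intro mult_mono) auto
      then have "?X - real m * ?W / (2 * real rmax) \<le> (?X - real D * ?W) - real m * (L * real n)"
        by (simp add: L_def algebra_simps)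
      then have "2 powr (?X - real m * ?W / (2 * real rmax)) \<le> 2 powr ((?X - real D * ?W) - real m * (L * real n))"
        by simp
      also have "\<dots> = 2 powr (?X - real D * ?W) * (2 powr (- L * real n)) ^ m"
        by (simp add: powr_diff powr_minus powr_power powr_add field_simps)
      also have "\<dots> \<le> 2 ^ expo K n * (2 powr (- L * real n)) ^ m"
        using e by (intro mult_right_mono) auto
      finally show ?thesis by (simp add: field_simps)
    qed
    have e2: "2 powr (?X - (real D + 1/2) * ?W) / 2 ^ expo K n \<le> 2 powr (- real n)"
    proof -
      have "2 powr (?X - (real D + 1/2) * ?W) \<le> 2 powr ((?X - real D * ?W) + (- real n))"
        using W by (simp add: algebra_simps)
      also have "\<dots> = 2 powr (?X - real D * ?W) * 2 powr (- real n)" by (rule powr_add)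
      also have "\<dots> \<le> 2 ^ expo K n * 2 powr (- real n)" using e by (intro mult_right_mono) auto
      finally show ?thesis by (simp add: field_simps)
    qed
    have Ceq: "real ((s\<^sub>0 + 1) * n ^ s\<^sub>0 * 2 ^ fact s\<^sub>0) = C * real n ^ s\<^sub>0"
      by (simp add: C_def algebra_simps)
    have "real (card (bad D n)) / 2 ^ expo K n \<le>
      ((\<Sum>m\<in>{s\<^sub>1<..n}. (real n ^ 2) ^ m * 2 powr (?X - real m * ?W / (2 * real rmax)))
      + real ((s\<^sub>0 + 1) * n ^ s\<^sub>0 * 2 ^ fact s\<^sub>0) * 2 powr (?X - (real D + 1/2) * ?W)) / 2 ^ expo K n"
      using card_bad_bound[of n D] elim by (intro divide_right_mono) (simp_all add: s\<^sub>0_def s\<^sub>1_def)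
    also have "\<dots> = (\<Sum>m\<in>{s\<^sub>1<..n}. (real n ^ 2) ^ m * (2 powr (?X - real m * ?W / (2 * real rmax)) / 2 ^ expo K n))
      + C * real n ^ s\<^sub>0 * (2 powr (?X - (real D + 1/2) * ?W) / 2 ^ expo K n)"
      unfolding Ceq by (simp add: add_divide_distrib sum_divide_distrib)
    also have "\<dots> \<le> (\<Sum>m\<in>{s\<^sub>1<..n}. real n ^ 2 * 2 powr (- L * real n)) + C * real n ^ s\<^sub>0 * 2 powr (- real n)"
    proof (intro add_mono sum_mono mult_left_mono e2)
      fix m assume m: "m \<in> {s\<^sub>1<..n}"
      have "(real n ^ 2) ^ m * (2 powr (?X - real m * ?W / (2 * real rmax)) / 2 ^ expo K n)
        \<le> (real n ^ 2) ^ m * (2 powr (- L * real n)) ^ m"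
        using e1[OF m] by (intro mult_left_mono) auto
      also have "\<dots> = (real n ^ 2 * 2 powr (- L * real n)) ^ m" by (simp add: power_mult_distrib)
      also have "\<dots> \<le> (real n ^ 2 * 2 powr (- L * real n)) ^ 1"
        using m elim(1) by (intro power_decreasing) auto
      finally show "(real n ^ 2) ^ m * (2 powr (?X - real m * ?W / (2 * real rmax)) / 2 ^ expo K n)
        \<le> real n ^ 2 * 2 powr (- L * real n)" by simp
    qed (simp add: C_def)
    also have "\<dots> \<le> real n * (real n ^ 2 * 2 powr (- L * real n)) + C * real n ^ s\<^sub>0 * 2 powr (- real n)"
      unfolding sum_constant by (intro add_right_mono mult_right_mono) auto
    finally show ?case by (rule mult_left_mono) simp
  qed
  then show ?thesis
    by (intro tendsto_sandwich[OF _ _ tendsto_const u]) auto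
qed

end

section \<open>Counting structures by an invariant property of the automorphism group\<close>

definition conjugate :: "('v \<Rightarrow> 'v) \<Rightarrow> ('v \<Rightarrow> 'v) set \<Rightarrow> ('v \<Rightarrow> 'v) set"
  where "conjugate h K = (\<lambda>f. h \<circ> f \<circ> perm_inv h) ` K"

lemma moved_conj: "bij h \<Longrightarrow> moved (h \<circ> f \<circ> perm_inv h) = h ` moved f"
proof -
  assume h: "bij h"
  have "x \<in> moved (h \<circ> f \<circ> perm_inv h) \<longleftrightarrow> perm_inv h x \<in> moved f" for x
    using h by (simp add: moved_def) (metis bij_inv_eq_iff)
  then have "moved (h \<circ> f \<circ> perm_inv h) = perm_inv h -` moved f" by auto
  then show ?thesis using bij_vimage_eq_inv_image[OF bij_imp_bij_inv[OF h]] h by (simp add: inv_inv_eq)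
qed

lemma inj_conj: "bij h \<Longrightarrow> inj (\<lambda>f. h \<circ> f \<circ> perm_inv h)"
proof (rule injI)
  fix f g assume h: "bij h" and eq: "h \<circ> f \<circ> perm_inv h = h \<circ> g \<circ> perm_inv h"
  have "perm_inv h \<circ> (h \<circ> f \<circ> perm_inv h) \<circ> h = f" for f
    using h by (auto simp: fun_eq_iff bij_is_inj)
  then show "f = g" using eq by metis
qed

lemma support_conjugate: "bij h \<Longrightarrow> support (conjugate h K) = h ` support K"
  by (auto simp: support_def conjugate_def moved_conj)

lemma defect_conjugate: "bij h \<Longrightarrow> defect (conjugate h K) = defect K"
proof -
  assume h: "bij h"
  have inj: "inj_on (\<lambda>f. h \<circ> f \<circ> perm_inv h) K" using inj_conj[OF h] by (rule inj_on_subset) simp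
  have "card (moved (h \<circ> f \<circ> perm_inv h)) = card (moved f)" for f
    unfolding moved_conj[OF h] using h by (intro card_image) (auto simp: bij_def inj_on_def)
  then show ?thesis
    by (simp add: defect_def conjugate_def sum.reindex[OF inj] card_image[OF inj])
qed

lemma permutes_conj:
  assumes "f permutes S" "bij h" shows "(h \<circ> f \<circ> perm_inv h) permutes (h ` S)"
  unfolding permutes_def
proof (intro conjI allI impI)
  have "bij (h \<circ> f \<circ> perm_inv h)"
    using assms by (intro bij_comp bij_imp_bij_inv permutes_bij[OF assms(1)])
  then show "\<exists>!x. (h \<circ> f \<circ> perm_inv h) x = y" for y by (simp add: bij_iff)
  show "(h \<circ> f \<circ> perm_inv h) x = x" if "x \<notin> h ` S" for x
  proof -
    have "perm_inv h x \<notin> S" using that assms(2) by (metis bij_inv_eq_iff image_eqI)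
    then show ?thesis using assms by (simp add: permutes_not_in) (metis bij_inv_eq_iff)
  qed
qed

lemma permutes_exists_image:
  assumes "finite A" "S \<subseteq> A" "T \<subseteq> A" "card S = card T"
  shows "\<exists>h. h permutes A \<and> h ` S = T"
proof -
  have fin: "finite S" "finite T" using assms finite_subset by blast+
  obtain f where f: "bij_betw f S T" using fin assms(4) by (metis bij_betw_iff_card)
  have "card (A - S) = card (A - T)" using fin assms by (simp add: card_Diff_subset)
  then obtain g where g: "bij_betw g (A - S) (A - T)" using assms(1) by (metis bij_betw_iff_card finite_Diff)
  define h where "h = (\<lambda>x. if x \<in> S then f x else if x \<in> A then g x else x)"
  have hS: "bij_betw h S T" using f by (rule bij_betw_cong[THEN iffD1, rotated]) (simp add: h_def)
  have "bij_betw h (A - S) (A - T)" using g by (rule bij_betw_cong[THEN iffD1, rotated]) (simp add: h_def)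
  from bij_betw_combine[OF hS this] have "bij_betw h A A" using assms by (auto simp: Un_absorb1)
  then have "h permutes A" by (rule bij_imp_permutes) (use assms in \<open>auto simp: h_def\<close>)
  then show ?thesis using hS by (auto simp: bij_betw_def)
qed

section \<open>Relabelling of structures\<close>

context vocabulary
begin

lemma stab_conjugate_subset:
  assumes h: "h permutes {1..n}" and "S \<subseteq> {1..n}" "R \<subseteq> cells n"
  shows "conjugate h (stab n S R) \<subseteq> stab n (h ` S) (act h ` R)"
proof
  fix f' assume "f' \<in> conjugate h (stab n S R)"
  then obtain f where f: "f \<in> stab n S R" and f': "f' = h \<circ> f \<circ> perm_inv h" by (auto simp: conjugate_def)
  have bij: "bij h" using h by (rule permutes_bij)
  have inv: "perm_inv h \<circ> h = id" "h \<circ> perm_inv h = id" using permutes_inv_o[OF h] by auto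
  have mem: "act h y \<in> act h ` R \<longleftrightarrow> y \<in> R" for y
    using inv(1) by (metis act_comp act_id image_iff)
  have "act f' x \<in> act h ` R \<longleftrightarrow> x \<in> act h ` R" if x: "x \<in> cells n" for x
  proof -
    define y where "y = act (perm_inv h) x"
    have y: "y \<in> cells n" "x = act h y"
      using x act_in_cells_iff[OF permutes_inv[OF h] subset_refl] inv(2) by (simp_all add: y_def flip: act_comp)
    have "act f' x = act h (act f y)" unfolding f' y_def by (simp add: act_comp)
    then show ?thesis using mem y f by (simp add: stab_def)
  qed
  then show "f' \<in> stab n (h ` S) (act h ` R)"
    using permutes_conj[OF _ bij, of f S] f f' by (simp add: stab_def)
qed

lemma act_image_image: "act g ` act f ` R = act (g \<circ> f) ` R"
  by (simp add: image_image act_comp)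

lemma act_image_subset_cells: "h permutes {1..n} \<Longrightarrow> R \<subseteq> cells n \<Longrightarrow> act h ` R \<subseteq> cells n"
  using act_in_cells_iff by blast

text \<open>The inclusion just shown, applied to the inverse relabelling, gives the other
  inclusion.\<close>

lemma stab_conjugate:
  assumes h: "h permutes {1..n}" and S: "S \<subseteq> {1..n}" and R: "R \<subseteq> cells n"
  shows "stab n (h ` S) (act h ` R) = conjugate h (stab n S R)"
proof (intro equalityI stab_conjugate_subset assms subsetI)
  fix f assume f: "f \<in> stab n (h ` S) (act h ` R)"
  have inv: "perm_inv h \<circ> h = id" "h \<circ> perm_inv h = id" using permutes_inv_o[OF h] by auto
  have "h ` S \<subseteq> {1..n}" using S permutes_image[OF h] by blast
  then have "conjugate (perm_inv h) (stab n (h ` S) (act h ` R)) \<subseteq>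
      stab n (perm_inv h ` h ` S) (act (perm_inv h) ` act h ` R)"
    using permutes_inv[OF h] act_image_subset_cells[OF h R] by (intro stab_conjugate_subset)
  moreover have "perm_inv h ` h ` S = S" using inv(1) by (simp add: image_comp)
  moreover have "act (perm_inv h) ` act h ` R = R" by (simp add: act_image_image inv)
  ultimately have "perm_inv h \<circ> f \<circ> h \<in> stab n S R"
    using f inv_inv_eq[OF permutes_bij[OF h]] by (auto simp: conjugate_def)
  moreover have "f = h \<circ> (perm_inv h \<circ> f \<circ> h) \<circ> perm_inv h"
    using inv by (metis comp_assoc comp_id id_comp)
  ultimately show "f \<in> conjugate h (stab n S R)" unfolding conjugate_def by blast
qed

end

text \<open>Instantiated with both isomorphism to and embedding of a group \<open>G\<close>. The
  witness in \<open>P_occurs\<close> is a stabilizer over some \<open>S\<close>, not a full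
  automorphism group, so a realizing structure may use points outside \<open>S\<close> as fixed
  marks.\<close>

locale invariant_property = relational_vocabulary +
  fixes P :: "(nat \<Rightarrow> nat) set \<Rightarrow> bool"
  assumes P_conjugate: "h permutes {1..n} \<Longrightarrow> perm_group {1..n} K \<Longrightarrow> P K \<Longrightarrow> P (conjugate h K)"
    and P_occurs: "\<exists>m S R. S \<subseteq> {1..m} \<and> R \<subseteq> cells m \<and> P (stab m S R)"
begin

definition min_defect :: nat
  where "min_defect = (LEAST d. \<exists>m S R. S \<subseteq> {1..m} \<and> R \<subseteq> cells m \<and> P (stab m S R) \<and> d = defect (stab m S R))"

lemma min_defect_attained:
  obtains m S R where "S \<subseteq> {1..m}" "R \<subseteq> cells m" "P (stab m S R)" "defect (stab m S R) = min_defect"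
proof -
  let ?Q = "\<lambda>d. \<exists>m S R. S \<subseteq> {1..m} \<and> R \<subseteq> cells m \<and> P (stab m S R) \<and> d = defect (stab m S R)"
  have "\<exists>d. ?Q d" using P_occurs by blast
  then have "?Q min_defect" unfolding min_defect_def by (rule LeastI_ex)
  then show thesis using that by metis
qed

lemma min_defect_le:
  "S \<subseteq> {1..m} \<Longrightarrow> R \<subseteq> cells m \<Longrightarrow> P (stab m S R) \<Longrightarrow> min_defect \<le> defect (stab m S R)"
  unfolding min_defect_def by (rule Least_le) blast

section \<open>Typical structures and their asymptotic number\<close>

definition typical :: "nat \<Rightarrow> nat set \<Rightarrow> (nat \<times> nat list) set set"
  where "typical n S = {R. R \<subseteq> cells n \<and> support (stab n S R) = S \<and>
    defect (stab n S R) = min_defect \<and> P (stab n S R)}"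

definition target :: "nat \<Rightarrow> (nat \<times> nat list) set set"
  where "target n = {R. R \<subseteq> cells n \<and> P (stab n {1..n} R)}"

definition small :: "nat \<Rightarrow> nat set set"
  where "small n = {S. S \<subseteq> {1..n} \<and> card S \<le> 2 * min_defect}"

text \<open>A structure can be typical for several \<open>S\<close>, so this sum may count it
  repeatedly. The overcount is confined to \<open>bad\<close> structures, as used in
  \<open>num_typical_le\<close>.\<close>

definition num_typical :: "nat \<Rightarrow> nat"
  where "num_typical n = (\<Sum>S\<in>small n. card (typical n S))"

lemma finite_typical: "finite (typical n S)" and finite_target: "finite (target n)"
  by (rule finite_subset[of _ "Pow (cells n)"]; auto simp: typical_def target_def finite_cells)+

lemma finite_small: "finite (small n)"
  by (rule finite_subset[of _ "Pow {1..n}"]) (auto simp: small_def)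

lemma card_typical_image_le:
  assumes h: "h permutes {1..n}" and S: "S \<subseteq> {1..n}"
  shows "card (typical n S) \<le> card (typical n (h ` S))"
proof (rule card_inj_on_le[of "image (act h)"])
  have "act (perm_inv h) ` act h ` R = R" for R
    using permutes_inv_o[OF h] by (simp add: act_image_image)
  then show "inj_on (image (act h)) (typical n S)" by (metis inj_onI)
  show "image (act h) ` typical n S \<subseteq> typical n (h ` S)"
  proof clarify
    fix R assume R: "R \<in> typical n S"
    then have sub: "R \<subseteq> cells n" by (simp add: typical_def)
    have pg: "perm_group {1..n} (stab n S R)"
      by (rule perm_group_mono[OF perm_group_stab[OF S] S])
    show "act h ` R \<in> typical n (h ` S)"
      using R act_image_subset_cells[OF h sub] P_conjugate[OF h pg] permutes_bij[OF h]
      by (simp add: typical_def stab_conjugate[OF h S sub] support_conjugate defect_conjugate)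
  qed
qed (rule finite_typical)

lemma card_typical_eq:
  assumes S: "S \<subseteq> {1..n}"
  shows "card (typical n S) = card (typical n {1..card S})"
proof -
  have "card S \<le> n" using card_mono[OF _ S] by simp
  then obtain h where h: "h permutes {1..n}" "h ` S = {1..card S}"
    using permutes_exists_image[of "{1..n}" S "{1..card S}"] S by auto
  have "perm_inv h ` {1..card S} = S"
    unfolding h(2)[symmetric] using permutes_inv_o(2)[OF h(1)] by (simp add: image_comp)
  then show ?thesis
    using card_typical_image_le[OF h(1) S] card_typical_image_le[OF permutes_inv[OF h(1)], of "{1..card S}"] h(2)
      \<open>card S \<le> n\<close> by simp
qed

definition types :: "nat \<Rightarrow> (nat \<Rightarrow> nat) set set"
  where "types s = {K. perm_group {1..s} K \<and> support K = {1..s} \<and> defect K = min_defect \<and> P K}"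

lemma finite_types: "finite (types s)"
  by (rule finite_subset[OF _ finite_perm_groups[of "{1..s}"]]) (auto simp: types_def)

lemma card_typical_types:
  assumes "s \<le> n"
  shows "card (typical n {1..s}) = (\<Sum>K\<in>types s. card (exact n {1..s} K))"
proof -
  have "{1..s} \<subseteq> {1..n}" using assms by auto
  then have "typical n {1..s} = (\<Union>K\<in>types s. exact n {1..s} K)"
    using perm_group_stab by (auto simp: typical_def types_def exact_def)
  then show ?thesis
    using finite_types finite_exact by (simp only:) (rule card_UN_disjoint, auto simp: exact_def)
qed

text \<open>All supports of size \<open>s\<close> contribute equally by relabelling, and over
  \<open>{1..s}\<close> the stabilizer ranges over finitely many groups. The index set no longer
  depends on \<open>n\<close>.\<close>

lemma num_typical_eq:
  "num_typical n = (\<Sum>(s, K)\<in>(SIGMA s:{..2 * min_defect}. types s). (n choose s) * card (exact n {1..s} K))"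
proof -
  have "num_typical n = (\<Sum>s\<in>{..2 * min_defect}. \<Sum>S\<in>{S \<in> small n. card S = s}. card (typical n S))"
    unfolding num_typical_def by (rule sum.group[symmetric]) (auto simp: finite_small, auto simp: small_def)
  also have "\<dots> = (\<Sum>s\<in>{..2 * min_defect}. (n choose s) * (\<Sum>K\<in>types s. card (exact n {1..s} K)))"
  proof (rule sum.cong[OF refl])
    fix s assume s: "s \<in> {..2 * min_defect}"
    have "{S \<in> small n. card S = s} = {S. S \<subseteq> {1..n} \<and> card S = s}" using s by (auto simp: small_def)
    moreover have "card (typical n S) = card (typical n {1..s})" if "S \<subseteq> {1..n}" "card S = s" for S
      using card_typical_eq that by blast
    ultimately have "(\<Sum>S\<in>{S \<in> small n. card S = s}. card (typical n S)) = (n choose s) * card (typical n {1..s})"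
      by (simp add: n_subsets)
    then show "(\<Sum>S\<in>{S \<in> small n. card S = s}. card (typical n S)) = (n choose s) * (\<Sum>K\<in>types s. card (exact n {1..s} K))"
      using card_typical_types[of s n] by (cases "s \<le> n") (simp_all add: binomial_eq_0)
  qed
  finally show ?thesis by (simp add: sum.Sigma finite_types sum_distrib_left)
qed

text \<open>Types that are never a stabilizer contribute 0 for every \<open>n\<close>. Discarding
  them leaves summands with a positive limit, as \<open>scaled\<close> demands.\<close>

definition realized :: "(nat \<times> (nat \<Rightarrow> nat) set) set"
  where "realized = {(s, K). s \<le> 2 * min_defect \<and> K \<in> types s \<and>
    (\<exists>m R. s \<le> m \<and> R \<subseteq> cells m \<and> stab m {1..s} R = K)}"

lemma finite_realized: "finite realized"
  by (rule finite_subset[of _ "SIGMA s:{..2 * min_defect}. types s"])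
    (auto simp: realized_def finite_types)

text \<open>Shrinking \<open>S\<close> to the support of an optimal stabilizer changes nothing, and
  \<open>card_typical_eq\<close> moves that support to an initial segment.\<close>

lemma realized_nonempty: "realized \<noteq> {}"
proof -
  obtain m S R where *: "S \<subseteq> {1..m}" "R \<subseteq> cells m" "P (stab m S R)" "defect (stab m S R) = min_defect"
    by (rule min_defect_attained)
  define T where "T = support (stab m S R)"
  have TS: "T \<subseteq> S" unfolding T_def by (rule support_subset[OF perm_group_stab[OF *(1)]])
  have "stab m T R = stab m S R" using TS by (intro stab_eq_if_support) (simp add: T_def)
  then have "R \<in> typical m T" using * by (simp add: typical_def T_def)
  have T: "T \<subseteq> {1..m}" using TS *(1) by blast
  have "card (typical m {1..card T}) > 0"
    using \<open>R \<in> typical m T\<close> card_typical_eq[OF T] finite_typical by (metis card_gt_0_iff empty_iff)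
  then obtain R' where R': "R' \<in> typical m {1..card T}" by (auto simp: card_gt_0_iff)
  have "card T \<le> m" using card_mono[OF _ T] by simp
  have "card T \<le> 2 * min_defect"
    unfolding T_def *(4)[symmetric] using *(1) finite_subset by (intro card_support_le[OF perm_group_stab]) auto
  moreover have "stab m {1..card T} R' \<in> types (card T)"
    using R' perm_group_stab[of "{1..card T}" m] \<open>card T \<le> m\<close> by (auto simp: typical_def types_def)
  ultimately have "(card T, stab m {1..card T} R') \<in> realized"
    using R' \<open>card T \<le> m\<close> by (auto simp: realized_def typical_def)
  then show ?thesis by blast
qed

lemma num_typical_realized:
  "num_typical n = (\<Sum>(s, K)\<in>realized. (n choose s) * card (exact n {1..s} K))"
proof -
  let ?T = "SIGMA s:{..2 * min_defect}. types s" and ?f = "\<lambda>(s, K). (n choose s) * card (exact n {1..s} K)"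
  have "\<forall>x\<in>?T - realized. ?f x = 0"
  proof
    fix x assume x: "x \<in> ?T - realized"
    obtain s K where [simp]: "x = (s, K)" by (cases x)
    have "exact n {1..s} K = {}" if "s \<le> n"
      using x that unfolding realized_def exact_def by auto
    then show "?f x = 0" by (cases "s \<le> n") (simp_all add: binomial_eq_0)
  qed
  moreover have "finite ?T" "realized \<subseteq> ?T" by (auto simp: realized_def finite_types)
  ultimately show ?thesis unfolding num_typical_eq by (intro sum.mono_neutral_right)
qed

lemma realized_limit:
  assumes "(s, K) \<in> realized"
  shows "\<exists>q\<in>\<rat>. q > 0 \<and> (\<lambda>n. real (card (exact n {1..s} K)) / 2 ^ expo K n) \<longlonglongrightarrow> q"
proof -
  obtain m R where "s \<le> m" "R \<subseteq> cells m" "K = stab m {1..s} R"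
    using assms unfolding realized_def by blast
  then show ?thesis by (intro exact_limit_pos[of "{1..s}" m R]) auto
qed

lemma scaled_realized:
  assumes "(s, K) \<in> realized"
  shows "scaled (\<lambda>n. real (n choose s) * real (card (exact n {1..s} K)))"
proof -
  have "quasi_poly (expo K)"
    using assms by (intro quasi_poly_expo[of "{1..s}" _ s]) (auto simp: realized_def types_def)
  moreover obtain q where "q \<in> \<rat>" "q > 0" "(\<lambda>n. real (card (exact n {1..s} K)) / 2 ^ expo K n) \<longlonglongrightarrow> q"
    using realized_limit[OF assms] by blast
  ultimately show ?thesis by (intro scaled_binomial_mult)
qed

lemma scaled_num_typical: "scaled (\<lambda>n. real (num_typical n))"
proof -
  have "scaled (\<lambda>n. \<Sum>x\<in>realized. real (n choose fst x) * real (card (exact n {1..fst x} (snd x))))"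
    using finite_realized realized_nonempty scaled_realized by (intro scaled_sum) auto
  then show ?thesis by (simp add: num_typical_realized case_prod_beta)
qed

text \<open>One realized pair already supplies eventually at least
  \<open>q / 2 * 2 ^ expo K n\<close> typical structures, and its group has exactly the defect to
  which \<open>bad_negligible\<close> refers.\<close>

lemma bad_div_num_typical:
  "(\<lambda>n. real n ^ k * (real (card (bad min_defect n)) / real (num_typical n))) \<longlonglongrightarrow> 0"
proof -
  obtain s K where sK: "(s, K) \<in> realized" using realized_nonempty by auto
  then have K: "perm_group {1..s} K" "defect K = min_defect" by (auto simp: realized_def types_def)
  obtain q where q: "q > 0" "(\<lambda>n. real (card (exact n {1..s} K)) / 2 ^ expo K n) \<longlonglongrightarrow> q"
    using realized_limit[OF sK] by blast
  have "\<forall>\<^sub>F n in sequentially. real (card (exact n {1..s} K)) / 2 ^ expo K n > q / 2"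
    using q by (intro order_tendstoD(1)[OF q(2)]) auto
  then have "\<forall>\<^sub>F n in sequentially. real n ^ k * (real (card (bad min_defect n)) / real (num_typical n))
      \<le> 2 / q * (real n ^ k * (real (card (bad min_defect n)) / 2 ^ expo K n))"
    using eventually_ge_at_top[of s]
  proof eventually_elim
    case (elim n)
    have "card (exact n {1..s} K) \<le> (n choose s) * card (exact n {1..s} K)"
      using elim(2) by (simp add: Suc_le_eq)
    also have "\<dots> \<le> num_typical n"
      unfolding num_typical_realized
      using member_le_sum[OF sK, of "\<lambda>(s, K). (n choose s) * card (exact n {1..s} K)"] finite_realized by simp
    finally have "real (card (exact n {1..s} K)) \<le> real (num_typical n)" by (rule of_nat_mono)
    moreover have "q / 2 * 2 ^ expo K n \<le> real (card (exact n {1..s} K))"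
      using elim(1) by (simp add: field_simps)
    ultimately have le: "q / 2 * 2 ^ expo K n \<le> real (num_typical n)" by linarith
    have pos: "0 < q / 2 * 2 ^ expo K n" using q(1) by simp
    have "real (card (bad min_defect n)) / real (num_typical n) \<le>
        real (card (bad min_defect n)) / (q / 2 * 2 ^ expo K n)"
      using le pos by (intro divide_left_mono mult_pos_pos[OF _ pos]) linarith+
    then have "real n ^ k * (real (card (bad min_defect n)) / real (num_typical n)) \<le>
        real n ^ k * (real (card (bad min_defect n)) / (q / 2 * 2 ^ expo K n))"
      by (rule mult_left_mono) simp
    then show ?case by (simp add: field_simps)
  qed
  note upper = this
  have "(\<lambda>n. 2 / q * (real n ^ k * (real (card (bad min_defect n)) / 2 ^ expo K n))) \<longlonglongrightarrow> 2 / q * 0"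
    by (intro tendsto_mult tendsto_const bad_negligible[OF K(1) subset_refl K(2)])
  then have lim: "(\<lambda>n. 2 / q * (real n ^ k * (real (card (bad min_defect n)) / 2 ^ expo K n))) \<longlonglongrightarrow> 0" by simp
  show ?thesis by (rule tendsto_sandwich[OF _ upper tendsto_const lim]) simp
qed

text \<open>A target structure that is not bad has minimal defect and is typical for the support of
  its full automorphism group, which is small by \<open>card_support_le\<close>.\<close>

lemma card_target_le: "card (target n) \<le> num_typical n + card (bad min_defect n)"
proof -
  have "target n \<subseteq> (\<Union>S\<in>small n. typical n S) \<union> bad min_defect n"
  proof
    fix R assume R: "R \<in> target n"
    let ?A = "stab n {1..n} R"
    have sub: "R \<subseteq> cells n" and P: "P ?A" using R by (auto simp: target_def)
    show "R \<in> (\<Union>S\<in>small n. typical n S) \<union> bad min_defect n"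
    proof (cases "defect ?A > min_defect")
      case False
      then have d: "defect ?A = min_defect" using min_defect_le[OF subset_refl sub P] by simp
      have pg: "perm_group {1..n} ?A" by (simp add: perm_group_stab)
      have S: "support ?A \<subseteq> {1..n}" by (rule support_subset[OF pg])
      have "stab n (support ?A) R = ?A" by (rule stab_eq_if_support[OF subset_refl S])
      then have "R \<in> typical n (support ?A)" using sub P d by (simp add: typical_def)
      moreover have "support ?A \<in> small n"
        using S card_support_le[OF pg] d by (simp add: small_def)
      ultimately show ?thesis by blast
    qed (use sub in \<open>simp add: bad_def\<close>)
  qed
  then have "card (target n) \<le> card ((\<Union>S\<in>small n. typical n S) \<union> bad min_defect n)"
    by (intro card_mono) (auto simp: finite_small finite_typical finite_bad)
  also have "\<dots> \<le> card (\<Union>S\<in>small n. typical n S) + card (bad min_defect n)" by (rule card_Un_le)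
  also have "card (\<Union>S\<in>small n. typical n S) \<le> num_typical n"
    unfolding num_typical_def by (rule card_UN_le[OF finite_small])
  finally show ?thesis by simp
qed

text \<open>Let a structure be typical for \<open>S\<close>. If all its automorphisms live on
  \<open>S\<close>, then \<open>S\<close> is the support of the full group, and these cases are
  disjoint for different \<open>S\<close>. Otherwise some automorphism moves a point outside
  \<open>S\<close>, which is a singleton orbit of the stabilizer over \<open>S\<close>, so the full
  defect exceeds the minimum and the structure is bad, possibly once for each small
  \<open>S\<close>.\<close>

lemma num_typical_le: "num_typical n \<le> card (target n) + card (small n) * card (bad min_defect n)"
proof -
  let ?T = "\<lambda>S. {R \<in> target n. support (stab n {1..n} R) = S}"
  have "card (typical n S) \<le> card (?T S) + card (bad min_defect n)" if S: "S \<in> small n" for S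
  proof -
    have Sn: "S \<subseteq> {1..n}" using S by (simp add: small_def)
    have "typical n S \<subseteq> ?T S \<union> bad min_defect n"
    proof
      fix R assume R: "R \<in> typical n S"
      let ?A = "stab n {1..n} R" and ?K = "stab n S R"
      have le: "?K \<subseteq> ?A" by (rule stab_subset[OF Sn])
      show "R \<in> ?T S \<union> bad min_defect n"
      proof (cases "?A = ?K")
        case True
        then show ?thesis using R by (auto simp: typical_def target_def)
      next
        case False
        then obtain g where g: "g \<in> ?A" "g \<notin> ?K" using le by blast
        then have gp: "g permutes {1..n}" by (simp add: stab_def)
        then have "\<not> moved g \<subseteq> S" using g permutes_iff_moved[OF gp, of S] by (auto simp: stab_def)
        then obtain x where x: "g x \<noteq> x" "x \<notin> S" by (auto simp: moved_def)
        then have "x \<in> {1..n}" using gp by (metis permutes_not_in)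
        moreover have "g x \<noteq> f x" if "f \<in> ?K" for f
          using that x by (auto simp: stab_def permutes_not_in)
        moreover have "perm_group {1..n} ?K" by (rule perm_group_mono[OF perm_group_stab[OF Sn] Sn])
        ultimately have "defect ?K < defect ?A"
          using defect_strict_mono[OF _ _ _ le g(1), of "{1..n}" x] perm_group_stab by blast
        then show ?thesis using R by (auto simp: typical_def bad_def)
      qed
    qed
    then have "card (typical n S) \<le> card (?T S \<union> bad min_defect n)"
      by (intro card_mono) (auto simp: finite_target finite_bad)
    also have "\<dots> \<le> card (?T S) + card (bad min_defect n)" by (rule card_Un_le)
    finally show ?thesis .
  qed
  then have "num_typical n \<le> (\<Sum>S\<in>small n. card (?T S) + card (bad min_defect n))"
    unfolding num_typical_def by (rule sum_mono)
  also have "\<dots> = (\<Sum>S\<in>small n. card (?T S)) + card (small n) * card (bad min_defect n)"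
    by (simp add: sum.distrib)
  also have "(\<Sum>S\<in>small n. card (?T S)) = card (\<Union>S\<in>small n. ?T S)"
    using finite_small finite_target by (intro card_UN_disjoint[symmetric]) auto
  also have "\<dots> \<le> card (target n)" by (intro card_mono finite_target) auto
  finally show ?thesis by simp
qed

text \<open>The two preceding inequalities enclose the count. The number of small supports is at
  most \<open>(?k + 1) * n ^ ?k\<close>, absorbed by the free power of \<open>n\<close> in
  \<open>bad_div_num_typical\<close>.\<close>

theorem scaled_card_target: "scaled (\<lambda>n. real (card (target n)))"
proof (rule scaled_asymp_equiv[OF scaled_num_typical])
  let ?b = "\<lambda>n. real (card (bad min_defect n))" and ?k = "2 * min_defect"
  let ?u = "\<lambda>n. real n ^ 0 * (?b n / real (num_typical n)) +
    real (?k + 1) * (real n ^ ?k * (?b n / real (num_typical n)))"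
  have "?u \<longlonglongrightarrow> 0 + real (?k + 1) * 0"
    by (intro tendsto_add tendsto_mult tendsto_const bad_div_num_typical)
  then have u: "?u \<longlonglongrightarrow> 0" by simp
  show "(\<lambda>n. (real (card (target n)) - real (num_typical n)) / real (num_typical n)) \<longlonglongrightarrow> 0"
  proof (rule tendsto_norm_zero_cancel, rule tendsto_sandwich[OF _ _ tendsto_const u])
    show "\<forall>\<^sub>F n in sequentially. norm ((real (card (target n)) - real (num_typical n)) / real (num_typical n)) \<le> ?u n"
      using eventually_gt_at_top[of 0]
    proof eventually_elim
      case (elim n)
      have "card (small n) \<le> (?k + 1) * n ^ ?k"
        unfolding small_def by (rule card_small_subsets[OF elim])
      then have "card (small n) * card (bad min_defect n) \<le> (?k + 1) * n ^ ?k * card (bad min_defect n)"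
        by (rule mult_le_mono1)
      then have "num_typical n \<le> card (target n) + (?k + 1) * n ^ ?k * card (bad min_defect n)"
        using num_typical_le[of n] by linarith
      from of_nat_mono[OF this, where 'a = real] of_nat_mono[OF card_target_le[of n], where 'a = real]
      have "\<bar>real (card (target n)) - real (num_typical n)\<bar> \<le> ?b n + real (?k + 1) * (real n ^ ?k * ?b n)"
        unfolding of_nat_add of_nat_mult of_nat_power mult.assoc by (smt (verit) mult_nonneg_nonneg of_nat_0_le_iff zero_le_power)
      then have "\<bar>real (card (target n)) - real (num_typical n)\<bar> / real (num_typical n)
          \<le> (?b n + real (?k + 1) * (real n ^ ?k * ?b n)) / real (num_typical n)"
        by (rule divide_right_mono) simp
      then show ?case by (simp add: add_divide_distrib)
    qed
  qed simp
qed

end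

section \<open>Realizing finite groups\<close>

context relational_vocabulary
begin

text \<open>
  Besides a fixed point \<open>Inr j\<close> marking the copy \<open>j\<close> of the group, the structure has the arrows
  \<open>(x, None) \<rightarrow> (x, Some y) \<rightarrow> (x y, None)\<close>, which encode the Cayley graph; hence the
  automorphisms are the left translations. An arrow \<open>(u, v)\<close> is turned into the tuple
  \<open>(u, v, \<dots>, v)\<close> of maximal length.
\<close>
lemma ex_stab_iso:
  fixes G :: "('a, 'c) monoid_scheme"
  assumes "group G" and fin: "finite (carrier G)"
  shows "\<exists>m S R. S \<subseteq> {1..m} \<and> R \<subseteq> cells m \<and> G \<cong> PermGroup (stab m S R)"
proof -
  interpret G: group G by fact
  obtain i where i: "i \<in> {1..\<rho>}" "ar i = rmax"
  proof -
    have "rmax \<in> ar ` {1..\<rho>}" unfolding rmax_def using \<rho>_pos by (intro Max_in) auto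
    then show thesis using that by auto
  qed
  \<comment> \<open>All group elements serve as generators. The copy \<open>Some y\<close> through
    which a path of length two passes reveals its label \<open>y\<close>, so one binary relation
    replaces a differently coloured edge relation for each generator.\<close>
  define J where "J = insert None (Some ` carrier G)"
  define U :: "('a \<times> 'a option + 'a option) set" where "U = Inl ` (carrier G \<times> J) \<union> Inr ` J"
  define E :: "('a \<times> 'a option + 'a option) rel" where
    "E = {(Inr j, Inl (x, j)) | x j. x \<in> carrier G \<and> j \<in> J} \<union>
      {(Inl (x, None), Inl (x, Some y)) | x y. x \<in> carrier G \<and> y \<in> carrier G} \<union>
      {(Inl (x, Some y), Inl (x \<otimes>\<^bsub>G\<^esub> y, None)) | x y. x \<in> carrier G \<and> y \<in> carrier G}"
  have "finite U" using fin by (simp add: U_def J_def)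
  then obtain h where h: "bij_betw h U {1..card U}"
    using finite_same_card_bij[of U "{1..card U}"] by auto
  define m where "m = card U"
  define S where "S = h ` Inl ` (carrier G \<times> J)"
  define tup :: "nat \<Rightarrow> nat \<Rightarrow> nat list" where "tup u v = u # replicate (rmax - 1) v" for u v
  define R where "R = {(i, tup (h u) (h v)) | u v. (u, v) \<in> E}"
  define hi where "hi = inv_into U h"
  have inj: "inj_on h U" and im: "h ` U = {1..m}" using h by (auto simp: bij_betw_def m_def)
  have hi: "hi (h u) = u" if "u \<in> U" for u using inj that by (simp add: hi_def)
  have tup_eq: "tup u v = tup u' v' \<longleftrightarrow> u = u' \<and> v = v'" for u v u' v'
    using rmax_ge(1) by (auto simp: tup_def)
  have map_tup: "map f (tup u v) = tup (f u) (f v)" for f u v by (simp add: tup_def)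
  have EU: "u \<in> U" "v \<in> U" if "(u, v) \<in> E" for u v
    using that by (auto simp: E_def U_def J_def)
  have S: "S \<subseteq> {1..m}" unfolding im[symmetric] S_def U_def by auto
  have tup_cells: "(i, tup (h u) (h v)) \<in> cells m" if "u \<in> U" "v \<in> U" for u v
    using that im i rmax_ge(1) by (auto simp: cells_def tuples_def tup_def)
  have R: "R \<subseteq> cells m" using tup_cells EU by (auto simp: R_def)
  have R_iff: "(i, tup (h u) (h v)) \<in> R \<longleftrightarrow> (u, v) \<in> E" if "u \<in> U" "v \<in> U" for u v
    using that EU inj by (auto simp: R_def tup_eq inj_on_eq_iff)
  have InrS: "h (Inr j) \<notin> S" if "j \<in> J" for j
  proof
    assume "h (Inr j) \<in> S"
    then obtain z where "z \<in> carrier G \<times> J" "h (Inr j) = h (Inl z)" by (auto simp: S_def)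
    moreover have "Inr j \<in> U" "Inl z \<in> U" using that calculation(1) by (auto simp: U_def)
    ultimately show False using inj_onD[OF inj] by blast
  qed
  define L :: "'a \<Rightarrow> 'a \<times> 'a option + 'a option \<Rightarrow> 'a \<times> 'a option + 'a option"
    where "L a = case_sum (\<lambda>(x, j). Inl (a \<otimes>\<^bsub>G\<^esub> x, j)) Inr" for a
  have L_simps [simp]: "L a (Inl (x, j)) = Inl (a \<otimes>\<^bsub>G\<^esub> x, j)" "L a (Inr j) = Inr j" for a x j
    by (simp_all add: L_def)
  define \<psi> where "\<psi> a p = (if p \<in> {1..m} then h (L a (hi p)) else p)" for a p
  have LU: "L a u \<in> U" if "a \<in> carrier G" "u \<in> U" for a u
    using that by (auto simp: U_def)
  have \<psi>_h: "\<psi> a (h u) = h (L a u)" if "u \<in> U" for a u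
    using that hi im by (auto simp: \<psi>_def)
  have \<psi>_out: "\<psi> a p = p" if "p \<notin> {1..m}" for a p
    unfolding \<psi>_def using that by (rule if_not_P)
  have \<psi>_comp: "\<psi> a \<circ> \<psi> b = \<psi> (a \<otimes>\<^bsub>G\<^esub> b)" if "a \<in> carrier G" "b \<in> carrier G" for a b
  proof
    fix p
    show "(\<psi> a \<circ> \<psi> b) p = \<psi> (a \<otimes>\<^bsub>G\<^esub> b) p"
    proof (cases "p \<in> {1..m}")
      case True
      then obtain u where u: "u \<in> U" "p = h u" using im by blast
      have "L a (L b u) = L (a \<otimes>\<^bsub>G\<^esub> b) u"
        using that u(1) by (auto simp: U_def G.m_assoc)
      then show ?thesis using u that LU by (simp add: \<psi>_h)
    next
      case False
      then show ?thesis by (simp only: o_apply \<psi>_out[OF False])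
    qed
  qed
  have \<psi>_one: "\<psi> \<one>\<^bsub>G\<^esub> = id"
  proof
    fix p
    show "\<psi> \<one>\<^bsub>G\<^esub> p = id p"
    proof (cases "p \<in> {1..m}")
      case True
      then obtain u where u: "u \<in> U" "p = h u" using im by blast
      then have "L \<one>\<^bsub>G\<^esub> u = u" by (auto simp: U_def)
      then show ?thesis using u by (simp add: \<psi>_h)
    next
      case False
      then show ?thesis by (simp only: \<psi>_out[OF False] id_apply)
    qed
  qed
  have \<psi>_inv: "\<psi> a \<circ> \<psi> (inv\<^bsub>G\<^esub> a) = id" "\<psi> (inv\<^bsub>G\<^esub> a) \<circ> \<psi> a = id" if "a \<in> carrier G" for a
    using that \<psi>_comp \<psi>_one by auto
  have \<psi>_R: "act (\<psi> a) x \<in> R" if "a \<in> carrier G" "x \<in> R" for a x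
  proof -
    obtain u v where uv: "(u, v) \<in> E" "x = (i, tup (h u) (h v))" using \<open>x \<in> R\<close> by (auto simp: R_def)
    have "(L a u, L a v) \<in> E" using uv(1) that(1) by (auto simp: E_def G.m_assoc)
    then show ?thesis using uv EU[OF uv(1)] by (auto simp: act_def map_tup \<psi>_h R_def)
  qed
  have \<psi>_stab: "\<psi> a \<in> stab m S R" if a: "a \<in> carrier G" for a
    unfolding stab_def
  proof (intro CollectI conjI ballI)
    have "bij (\<psi> a)" using \<psi>_inv[OF a] by (rule o_bij[rotated])
    moreover have "\<psi> a p = p" if "p \<notin> S" for p
    proof (cases "p \<in> {1..m}")
      case True
      then obtain u where "u \<in> U" "p = h u" using im by blast
      then show ?thesis using that by (auto simp: U_def S_def \<psi>_h)
    qed (rule \<psi>_out)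
    ultimately show "\<psi> a permutes S" by (simp add: permutes_def bij_iff)
    show "act (\<psi> a) x \<in> R \<longleftrightarrow> x \<in> R" for x
      using \<psi>_R[OF a, of x] \<psi>_R[OF G.inv_closed[OF a], of "act (\<psi> a) x"] \<psi>_inv(2)[OF a]
      by (auto simp flip: act_comp)
  qed
  have surj: "\<exists>a\<in>carrier G. f = \<psi> a" if f: "f \<in> stab m S R" for f
  proof -
    have fS: "f permutes S" using f by (simp add: stab_def)
    define f' where "f' u = hi (f (h u))" for u
    have "f (h u) \<in> {1..m}" if "u \<in> U" for u
      using that im permutes_in_image[OF permutes_subset[OF fS S], of "h u"] by blast
    then have f': "f' u \<in> U" "f (h u) = h (f' u)" if "u \<in> U" for u
      using that im hi unfolding f'_def by (metis imageE)+
    have f'E: "(f' u, f' v) \<in> E" if "(u, v) \<in> E" for u v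
    proof -
      note uv = EU[OF that]
      have "act f (i, tup (h u) (h v)) \<in> R"
        using f tup_cells[OF uv] R_iff[OF uv] that by (simp add: stab_def)
      then show ?thesis using f'(1)[OF uv(1)] f'(1)[OF uv(2)] R_iff by (simp add: act_def map_tup f'(2)[OF uv(1)] f'(2)[OF uv(2)])
    qed
    \<comment> \<open>The marks lie outside \<open>S\<close>, so elements of the stabilizer fix them
      whatever \<open>R\<close> is; through the marks every copy is preserved.\<close>
    have f'Inr: "f' (Inr j) = Inr j" if "j \<in> J" for j
      using that permutes_not_in[OF fS InrS[OF that]] hi by (simp add: f'_def U_def)
    have "\<exists>y\<in>carrier G. f' (Inl (x, j)) = Inl (y, j)" if "x \<in> carrier G" "j \<in> J" for x j
    proof -
      have "(Inr j, Inl (x, j)) \<in> E" using that by (auto simp: E_def)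
      then have "(Inr j, f' (Inl (x, j))) \<in> E" using f'E f'Inr that(2) by metis
      then show ?thesis by (auto simp: E_def)
    qed
    then obtain \<alpha> where \<alpha>: "\<alpha> x j \<in> carrier G" "f' (Inl (x, j)) = Inl (\<alpha> x j, j)"
      if "x \<in> carrier G" "j \<in> J" for x j by metis
    define a where "a = \<alpha> \<one>\<^bsub>G\<^esub> None"
    have J: "None \<in> J" "y \<in> carrier G \<Longrightarrow> Some y \<in> J" for y by (auto simp: J_def)
    have a: "a \<in> carrier G" using \<alpha>(1) J by (simp add: a_def)
    \<comment> \<open>The first kind of arrow makes \<open>\<alpha> x j\<close> independent of the
      copy \<open>j\<close>, the second makes it commute with right multiplication; evaluation at
      the unit then shows left translation by \<open>a\<close>.\<close>
    have \<alpha>1: "\<alpha> x (Some y) = \<alpha> x None" if "x \<in> carrier G" "y \<in> carrier G" for x y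
    proof -
      have "(Inl (x, None), Inl (x, Some y)) \<in> E" using that by (auto simp: E_def)
      from f'E[OF this] show ?thesis using \<alpha>(2) that J by (auto simp: E_def)
    qed
    have \<alpha>2: "\<alpha> (x \<otimes>\<^bsub>G\<^esub> y) None = \<alpha> x (Some y) \<otimes>\<^bsub>G\<^esub> y" if "x \<in> carrier G" "y \<in> carrier G" for x y
    proof -
      have "(Inl (x, Some y), Inl (x \<otimes>\<^bsub>G\<^esub> y, None)) \<in> E" using that by (auto simp: E_def)
      from f'E[OF this] show ?thesis using \<alpha>(2) that J by (auto simp: E_def)
    qed
    have "\<alpha> y None = a \<otimes>\<^bsub>G\<^esub> y" if "y \<in> carrier G" for y
      using \<alpha>2[of "\<one>\<^bsub>G\<^esub>" y] \<alpha>1[of "\<one>\<^bsub>G\<^esub>" y] that by (simp add: a_def)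
    then have \<alpha>3: "\<alpha> x j = a \<otimes>\<^bsub>G\<^esub> x" if "x \<in> carrier G" "j \<in> J" for x j
      using that \<alpha>1 by (auto simp: J_def)
    have "f' u = L a u" if "u \<in> U" for u
      using that \<alpha>(2) \<alpha>3 f'Inr by (auto simp: U_def)
    then have fU: "f (h u) = \<psi> a (h u)" if "u \<in> U" for u using that f'(2) \<psi>_h by simp
    have "f p = \<psi> a p" for p
    proof (cases "p \<in> {1..m}")
      case True
      then obtain u where "u \<in> U" "p = h u" using im by blast
      then show ?thesis using fU by simp
    next
      case False
      then have "p \<notin> S" using S by blast
      then show ?thesis using permutes_not_in[OF fS] \<psi>_out[OF False] by simp
    qed
    then have "f = \<psi> a" by blast
    then show ?thesis using a by blast
  qed
  have inj\<psi>: "inj_on \<psi> (carrier G)"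
  proof (rule inj_onI)
    fix a b assume ab: "a \<in> carrier G" "b \<in> carrier G" "\<psi> a = \<psi> b"
    have u: "Inl (\<one>\<^bsub>G\<^esub>, None) \<in> U" by (auto simp: U_def J_def)
    have "h (L a (Inl (\<one>\<^bsub>G\<^esub>, None))) = h (L b (Inl (\<one>\<^bsub>G\<^esub>, None)))"
      using ab(3) \<psi>_h[OF u] by metis
    then have "L a (Inl (\<one>\<^bsub>G\<^esub>, None)) = L b (Inl (\<one>\<^bsub>G\<^esub>, None))"
      using inj LU[OF _ u] ab by (simp only: inj_on_eq_iff)
    then show "a = b" using ab by simp
  qed
  have "\<psi> ` carrier G = stab m S R" using \<psi>_stab surj by blast
  then have "\<psi> \<in> iso G (PermGroup (stab m S R))"
    using inj\<psi> \<psi>_stab \<psi>_comp by (auto simp: iso_def bij_betw_def intro!: homI)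
  then have "G \<cong> PermGroup (stab m S R)" by (auto simp: is_iso_def)
  then show ?thesis using S R by blast
qed

end

section \<open>Limits of quotients\<close>

lemma embeds_iso:
  assumes "group H" "group H'" "H \<cong> H'" "G \<lesssim>\<^sub>g H"
  shows "G \<lesssim>\<^sub>g H'"
proof -
  obtain K where K: "subgroup K H" "G \<cong> H\<lparr>carrier := K\<rparr>"
    using assms(4) unfolding iso_to_subgroup_def by blast
  obtain \<phi> where \<phi>: "\<phi> \<in> iso H H'" using assms(3) by (auto simp: is_iso_def)
  have "H\<lparr>carrier := K\<rparr> \<cong> H'\<lparr>carrier := \<phi> ` K\<rparr>"
    by (rule is_isoI[OF iso_restrict[OF \<phi> assms(1,2) K(1)]])
  then have "G \<cong> H'\<lparr>carrier := \<phi> ` K\<rparr>" by (rule iso_trans[OF K(2)])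
  moreover have "subgroup (\<phi> ` K) H'" by (rule subgroup.iso_subgroup[OF K(1) assms(1,2) \<phi>])
  ultimately show ?thesis unfolding iso_to_subgroup_def by blast
qed

lemma perm_group_conjugate:
  assumes h: "h permutes S" and K: "perm_group S K"
  shows "perm_group S (conjugate h K)" and "PermGroup K \<cong> PermGroup (conjugate h K)"
proof -
  have bij: "bij h" using h by (rule permutes_bij)
  have comp: "(h \<circ> f \<circ> perm_inv h) \<circ> (h \<circ> g \<circ> perm_inv h) = h \<circ> (f \<circ> g) \<circ> perm_inv h" for f g
    using permutes_inv_o(2)[OF h] by (metis comp_assoc comp_id)
  have inv: "perm_inv (h \<circ> f \<circ> perm_inv h) = h \<circ> perm_inv f \<circ> perm_inv h" if "f \<in> K" for f
  proof -
    have f: "f permutes S" using that K by (rule perm_groupD(1)[rotated])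
    show ?thesis
      using comp[of f "perm_inv f"] comp[of "perm_inv f" f] permutes_inv_o[OF f] permutes_inv_o[OF h]
      by (intro inv_unique_comp) simp_all
  qed
  show pg: "perm_group S (conjugate h K)"
    unfolding perm_group_def
  proof (intro conjI ballI)
    fix f assume "f \<in> conjugate h K"
    then obtain f' where f': "f' \<in> K" "f = h \<circ> f' \<circ> perm_inv h" by (auto simp: conjugate_def)
    then show "f permutes S"
      using permutes_conj[OF perm_groupD(1)[OF K f'(1)] bij] permutes_image[OF h] by simp
    show "perm_inv f \<in> conjugate h K"
      using f' inv perm_groupD(4)[OF K] by (auto simp: conjugate_def)
    fix g assume "g \<in> conjugate h K"
    then obtain g' where g': "g' \<in> K" "g = h \<circ> g' \<circ> perm_inv h" by (auto simp: conjugate_def)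
    have "f \<circ> g = h \<circ> (f' \<circ> g') \<circ> perm_inv h" unfolding f' g' by (rule comp)
    then show "f \<circ> g \<in> conjugate h K" using perm_groupD(3)[OF K f'(1) g'(1)] by (auto simp: conjugate_def)
  next
    have "id = h \<circ> id \<circ> perm_inv h" using permutes_inv_o(1)[OF h] by simp
    then show "id \<in> conjugate h K" using perm_groupD(2)[OF K] unfolding conjugate_def by (rule image_eqI)
  qed
  have "(\<lambda>f. h \<circ> f \<circ> perm_inv h) \<in> hom (PermGroup K) (PermGroup (conjugate h K))"
  proof (rule homI)
    fix f g
    show "h \<circ> (f \<otimes>\<^bsub>PermGroup K\<^esub> g) \<circ> perm_inv h =
        (h \<circ> f \<circ> perm_inv h) \<otimes>\<^bsub>PermGroup (conjugate h K)\<^esub> (h \<circ> g \<circ> perm_inv h)"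
      by (simp only: PermGroup_simps comp)
  qed (simp add: conjugate_def)
  moreover have "bij_betw (\<lambda>f. h \<circ> f \<circ> perm_inv h) K (conjugate h K)"
    unfolding bij_betw_def conjugate_def using inj_conj[OF bij] by (auto intro: inj_on_subset)
  ultimately show "PermGroup K \<cong> PermGroup (conjugate h K)"
    by (intro is_isoI) (simp add: iso_def)
qed

section \<open>Translation between structures and sets of cells\<close>

context vocabulary
begin

definition cells_of :: "nat rel_structure \<Rightarrow> (nat \<times> nat list) set"
  where "cells_of \<M> = (SIGMA i:{1..\<rho>}. rel \<M> i)"

lemma bij_betw_cells_of: "bij_betw cells_of (structures_on \<rho> ar n) (Pow (cells n))"
proof (rule bij_betwI)
  let ?g = "\<lambda>R. \<lparr>universe = {1..n}, rel = (\<lambda>i. {xs. (i, xs) \<in> R})\<rparr>"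
  show "cells_of \<in> structures_on \<rho> ar n \<rightarrow> Pow (cells n)"
    by (fastforce simp: cells_of_def structures_on_def is_structure_def cells_def)
  show "?g \<in> Pow (cells n) \<rightarrow> structures_on \<rho> ar n"
    by (fastforce simp: structures_on_def is_structure_def cells_def)
  show "?g (cells_of \<M>) = \<M>" if "\<M> \<in> structures_on \<rho> ar n" for \<M>
    using that by (cases \<M>) (auto simp: cells_of_def structures_on_def is_structure_def fun_eq_iff)
  show "cells_of (?g R) = R" if "R \<in> Pow (cells n)" for R
    using that by (auto simp: cells_of_def cells_def)
qed

text \<open>The two groups differ only in the values outside the universe: identity for
  permutations, \<open>undefined\<close> for elements of \<open>Bij\<close>. Restriction converts
  the first into the second.\<close>

lemma stab_iso_Aut:
  assumes M: "\<M> \<in> structures_on \<rho> ar n"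
  shows "PermGroup (stab n {1..n} (cells_of \<M>)) \<cong> Aut \<rho> ar \<M>"
proof -
  let ?N = "{1..n}" and ?K = "stab n {1..n} (cells_of \<M>)"
  let ?r = "\<lambda>f. restrict f ?N"
  have U: "universe \<M> = ?N" using M by (simp add: structures_on_def)
  have mem: "act f (i, xs) \<in> cells_of \<M> \<longleftrightarrow> map f xs \<in> rel \<M> i" if "i \<in> {1..\<rho>}" for f i xs
    using that by (simp add: act_def cells_of_def)
  have map_r: "map (?r f) xs = map f xs" if "xs \<in> tuples k ?N" for f xs k
    using that by (auto simp: tuples_def)
  have K_iff: "f \<in> ?K \<longleftrightarrow> f permutes ?N \<and> (\<forall>i\<in>{1..\<rho>}. \<forall>xs\<in>tuples (ar i) ?N. map f xs \<in> rel \<M> i \<longleftrightarrow> xs \<in> rel \<M> i)" for f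
    unfolding stab_def cells_def using mem[of _ f] mem[of _ id] by fastforce
  have aut_iff: "?r f \<in> automorphisms \<rho> ar \<M> \<longleftrightarrow> ?r f \<in> Bij ?N \<and> (\<forall>i\<in>{1..\<rho>}. \<forall>xs\<in>tuples (ar i) ?N. map f xs \<in> rel \<M> i \<longleftrightarrow> xs \<in> rel \<M> i)" for f
    unfolding automorphisms_def U mem_Collect_eq by (intro conj_cong refl ball_cong) (simp only: map_r)
  have Bij: "?r f \<in> Bij ?N" if "f permutes ?N" for f
    using permutes_imp_bij[OF that] by (simp add: Bij_def)
  have "?r \<in> hom (PermGroup ?K) (Aut \<rho> ar \<M>)"
  proof (rule homI)
    fix f assume "f \<in> carrier (PermGroup ?K)"
    then show "?r f \<in> carrier (Aut \<rho> ar \<M>)" using Bij K_iff aut_iff by (simp add: Aut_def)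
  next
    fix f g assume "f \<in> carrier (PermGroup ?K)" "g \<in> carrier (PermGroup ?K)"
    then have p: "f permutes ?N" "g permutes ?N" using K_iff by auto
    have "restrict (f \<circ> g) ?N = compose ?N (?r f) (?r g)"
      using permutes_in_image[OF p(2)] by (auto simp: compose_def fun_eq_iff simp del: atLeastAtMost_iff)
    then show "?r (f \<otimes>\<^bsub>PermGroup ?K\<^esub> g) = ?r f \<otimes>\<^bsub>Aut \<rho> ar \<M>\<^esub> ?r g"
      using Bij[OF p(1)] Bij[OF p(2)] by (simp add: Aut_def BijGroup_def U)
  qed
  moreover have "bij_betw ?r ?K (automorphisms \<rho> ar \<M>)"
    unfolding bij_betw_def
  proof
    show "inj_on ?r ?K"
    proof (rule inj_onI, rule ext)
      fix f g x assume "f \<in> ?K" "g \<in> ?K" and eq: "?r f = ?r g"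
      then have p: "f permutes ?N" "g permutes ?N" using K_iff by auto
      show "f x = g x"
      proof (cases "x \<in> ?N")
        case True
        then show ?thesis using fun_cong[OF eq, of x] by (simp only: restrict_apply if_True)
      next
        case False
        then show ?thesis using permutes_not_in[OF p(1)] permutes_not_in[OF p(2)] by metis
      qed
    qed
    show "?r ` ?K = automorphisms \<rho> ar \<M>"
    proof (intro equalityI subsetI)
      fix F assume F: "F \<in> automorphisms \<rho> ar \<M>"
      then have FB: "F \<in> Bij ?N" by (simp add: automorphisms_def U)
      \<comment> \<open>\<open>F\<close> is \<open>undefined\<close> outside the universe; the
        identity is put there instead to obtain a permutation.\<close>
      define f where "f x = (if x \<in> ?N then F x else x)" for x
      have rf: "?r f = F" using FB by (auto simp: f_def Bij_def extensional_def fun_eq_iff)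
      have "bij_betw F ?N ?N" using FB by (simp add: Bij_def)
      moreover have "bij_betw f ?N ?N \<longleftrightarrow> bij_betw F ?N ?N"
        by (rule bij_betw_cong) (simp only: f_def if_True)
      ultimately have "bij_betw f ?N ?N" by blast
      then have "f permutes ?N" by (rule bij_imp_permutes) (simp only: f_def if_False)
      then have "f \<in> ?K" using F aut_iff[of f] rf K_iff by simp
      then show "F \<in> ?r ` ?K" using rf by blast
    qed (use Bij K_iff aut_iff in auto)
  qed
  ultimately show ?thesis by (intro is_isoI[of ?r]) (simp add: iso_def Aut_def)
qed

end

lemma (in invariant_property) scaled_card_structures:
  assumes "\<And>n \<M>. \<M> \<in> structures_on \<rho> ar n \<Longrightarrow> Q \<M> \<longleftrightarrow> P (stab n {1..n} (cells_of \<M>))"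
  shows "scaled (\<lambda>n. real (card {\<M> \<in> structures_on \<rho> ar n. Q \<M>}))"
proof -
  have "card {\<M> \<in> structures_on \<rho> ar n. Q \<M>} = card (target n)" for n
  proof (rule bij_betw_same_card)
    have "Q \<M> \<longleftrightarrow> cells_of \<M> \<in> target n" if "\<M> \<in> structures_on \<rho> ar n" for \<M>
      using assms[OF that] bij_betwE[OF bij_betw_cells_of] that unfolding target_def by blast
    then have "{\<M> \<in> structures_on \<rho> ar n. Q \<M>} = {\<M> \<in> structures_on \<rho> ar n. cells_of \<M> \<in> target n}"
      by blast
    moreover have "target n \<subseteq> cells_of ` structures_on \<rho> ar n"
      using bij_betw_imp_surj_on[OF bij_betw_cells_of[of n]] by (auto simp: target_def)
    then have "cells_of ` {\<M> \<in> structures_on \<rho> ar n. cells_of \<M> \<in> target n} = target n" by blast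
    ultimately show "bij_betw cells_of {\<M> \<in> structures_on \<rho> ar n. Q \<M>} (target n)"
      using bij_betw_cells_of[of n] by (auto simp: bij_betw_def intro: inj_on_subset)
  qed
  then show ?thesis using scaled_card_target by simp
qed

lemma (in relational_vocabulary)
  fixes G :: "('a, 'c) monoid_scheme"
  assumes G: "group G" "finite (carrier G)"
  shows scaled_card_iso: "scaled (\<lambda>n. real (card {\<M> \<in> structures_on \<rho> ar n. G \<cong> Aut \<rho> ar \<M>}))"
    and scaled_card_embeds: "scaled (\<lambda>n. real (card {\<M> \<in> structures_on \<rho> ar n. G \<lesssim>\<^sub>g Aut \<rho> ar \<M>}))"
proof -
  have grp: "group (PermGroup (stab n {1..n} R))" for n R
    by (rule group_PermGroup[OF perm_group_stab[OF subset_refl]])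
  have iso': "Aut \<rho> ar \<M> \<cong> PermGroup (stab n {1..n} (cells_of \<M>))" if "\<M> \<in> structures_on \<rho> ar n" for n \<M>
    by (rule group.iso_sym[OF grp stab_iso_Aut[OF that]])
  interpret iso: invariant_property \<rho> ar "\<lambda>K. G \<cong> PermGroup K"
    using perm_group_conjugate(2) iso_trans ex_stab_iso[OF G] by unfold_locales blast+
  show "scaled (\<lambda>n. real (card {\<M> \<in> structures_on \<rho> ar n. G \<cong> Aut \<rho> ar \<M>}))"
    using iso_trans iso' stab_iso_Aut by (intro iso.scaled_card_structures) blast
  have refl: "G \<cong> PermGroup K \<Longrightarrow> G \<lesssim>\<^sub>g PermGroup K" if "perm_group S K" for S K
    using group.subgroup_self[OF group_PermGroup[OF that]] unfolding iso_to_subgroup_def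
    by (intro exI[of _ K]) (simp add: PermGroup_def)
  interpret emb: invariant_property \<rho> ar "\<lambda>K. G \<lesssim>\<^sub>g PermGroup K"
  proof
    show "G \<lesssim>\<^sub>g PermGroup (conjugate h K)"
      if "h permutes {1..n}" "perm_group {1..n} K" "G \<lesssim>\<^sub>g PermGroup K" for h n K
      using embeds_iso[OF group_PermGroup group_PermGroup] perm_group_conjugate that by blast
    show "\<exists>m S R. S \<subseteq> {1..m} \<and> R \<subseteq> cells m \<and> G \<lesssim>\<^sub>g PermGroup (stab m S R)"
      using ex_stab_iso[OF G] refl perm_group_stab by blast
  qed
  show "scaled (\<lambda>n. real (card {\<M> \<in> structures_on \<rho> ar n. G \<lesssim>\<^sub>g Aut \<rho> ar \<M>}))"
    using embeds_iso[OF grp group_Aut stab_iso_Aut] embeds_iso[OF group_Aut grp iso']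
    by (intro emb.scaled_card_structures) blast
qed

theorem theorem1p1:
  fixes \<rho> :: nat and ar :: "nat \<Rightarrow> nat"
    and G :: "('a, 'c) monoid_scheme" and H :: "('b, 'd) monoid_scheme"
  assumes "\<rho> \<ge> 1" and "Max (ar ` {1..\<rho>}) \<ge> 2"
    and "group G" and "finite (carrier G)"
    and "group H" and "finite (carrier H)"
  shows "quotient_limit_exists
           (\<lambda>n. card {\<M> \<in> structures_on \<rho> ar n. H \<lesssim>\<^sub>g Aut \<rho> ar \<M>})
           (\<lambda>n. card {\<M> \<in> structures_on \<rho> ar n. G \<lesssim>\<^sub>g Aut \<rho> ar \<M>})
       \<and> quotient_limit_exists
           (\<lambda>n. card {\<M> \<in> structures_on \<rho> ar n. H \<cong> Aut \<rho> ar \<M>})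
           (\<lambda>n. card {\<M> \<in> structures_on \<rho> ar n. G \<cong> Aut \<rho> ar \<M>})
       \<and> quotient_limit_exists
           (\<lambda>n. card {\<M> \<in> structures_on \<rho> ar n. G \<cong> Aut \<rho> ar \<M>})
           (\<lambda>n. card {\<M> \<in> structures_on \<rho> ar n. G \<lesssim>\<^sub>g Aut \<rho> ar \<M>})"
proof -
  interpret relational_vocabulary \<rho> ar using assms(1,2) by unfold_locales
  show ?thesis
    using scaled_card_iso[OF assms(3,4)] scaled_card_iso[OF assms(5,6)]
      scaled_card_embeds[OF assms(3,4)] scaled_card_embeds[OF assms(5,6)]
    by (intro conjI scaled_quotient_limit_exists)
qed

end
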